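(* Let $n,d\ge 1$ and let $g:\mathbb{R}^n\to \mathcal{M}_d(\mathbb{R})^+$ be an N-log-concave function. Assume that $\int_{\mathbb{R}^n}|g(x)|\,dx<+\infty$, where $|\cdot|$ is a norm on $\mathcal{M}_d(\mathbb{R})$, and set $\mathcal{Z}:=\int_{\mathbb{R}^n} g(x)\,dx\in\mathcal{M}_d(\mathbb{R})^+$. Then for every function $F:\mathbb{R}^n\to\mathbb{R}^d$ of class $C^1$ belonging to $L^2(g)$, $$\int_{\mathbb{R}^n}\Big\|F(x)-\mathcal{Z}^{-1}\int_{\mathbb{R}^n} g(z)F(z)\,dz\Big\|_{g(x)}^2\,dx\;\le\;\int_{\mathbb{R}^n}Q^\circ_{x}(\nabla_xF)\,dx,$$ where, for each $x\in\mathbb{R}^n$, $Q^\circ_x$ denotes the $\langle\cdot|\cdot\rangle_{\mathrm{Id}_n\otimes g(x)}$-polar of the quadratic form $Q_x(U)=-\langle\mathbf{\Theta}^g(x)U|U\rangle_{\mathrm{Id}_n\otimes g(x)}$ on $\mathcal{M}_{d,n}(\mathbb{R})$. If moreover $\mathbf{\Theta}^g(x)$ is invertible as an operator on $\mathcal{M}_{d,n}(\mathbb{R})$ for almost every $x\in\mathbb{R}^n$, then also $$\int_{\mathbb{R}^n}\Big\|F(x)-\mathcal{Z}^{-1}\int_{\mathbb{R}^n} g(z)F(z)\,dz\Big\|_{g(x)}^2\,dx\;\le\;\int_{\mathbb{R}^n}\big\langle(-\mathbf{\Theta}^g(x))^{-1}\nabla_xF\,\big|\,\nabla_xF\big\rangle_{\mathrm{Id}_n\otimes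 g(x)}\,dx.$$
   Context: Notation. $\mathcal{M}_d(\mathbb{R})^+$ is the set of (real) symmetric positive definite $d\times d$ matrices; $\mathcal{M}_{d,n}(\mathbb{R})$ is the space of real $d\times n$ matrices, written by columns $U=[u_1,\dots,u_n]$ with $u_k\in\mathbb{R}^d$. $\langle\cdot|\cdot\rangle$ is the standard scalar product on $\mathbb{R}^d$. For $h\in\mathcal{M}_d(\mathbb{R})^+$ and $u,v\in\mathbb{R}^d$, put $\langle u|v\rangle_h:=\langle hu|v\rangle$ and $\|u\|_h:=\sqrt{\langle hu|u\rangle}$. For $U=[u_1,\dots,u_n]$, $V=[v_1,\dots,v_n]\in\mathcal{M}_{d,n}(\mathbb{R})$ put $\langle U|V\rangle_{\mathrm{Id}_n\otimes h}:=\sum_{k=1}^n\langle hu_k|v_k\rangle$. For a $C^2$ function $g:\mathbb{R}^n\to\mathcal{M}_d(\mathbb{R})^+$, $1\le j,k\le n$ and $x\in\mathbb{R}^n$, define (derivatives taken entrywise) $$\theta^g_{j,k}(x):=\partial_{x_k}\big(g^{-1}\partial_{x_j}g\big)(x)\in\mathcal{M}_d(\mathbb{R}),$$ and let $\mathbf{\Theta}^g(x)$ be the linear operator on $\mathcal{M}_{d,n}(\mathbb{R})$ given by $$\mathbf{\Theta}^g(x)U:=\Big[\sum_{j=1}^n\theta^g_{j,k}(x)u_j\Big]_{k=1,\dots,n},\qquad U=[u_1,\dots,u_n].$$ This operator is symmetric for $\langle\cdot|\cdot\rangle_{\mathrm{Id}_n\otimes g(x)}$. Definition (N-log-concavity).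 A function $g:\mathbb{R}^n\to\mathcal{M}_d(\mathbb{R})^+$ is N-log-concave if it is $C^2$ and, for every $x\in\mathbb{R}^n$ and every $U\in\mathcal{M}_{d,n}(\mathbb{R})$, $\langle\mathbf{\Theta}^g(x)U|U\rangle_{\mathrm{Id}_n\otimes g(x)}\le 0$. Polar form. If $E$ is a finite-dimensional real vector space with scalar product $\langle\cdot|\cdot\rangle_*$ and $Q$ is a nonnegative quadratic form on $E$, the $\langle\cdot|\cdot\rangle_*$-polar of $Q$ is $Q^\circ(v):=\sup\{\langle u|v\rangle_*^2:\ u\in E,\ Q(u)\le 1\}\in[0,+\infty]$; equivalently $\tfrac12Q^\circ(v)=\sup_{u\in E}\{\langle u|v\rangle_*-\tfrac12Q(u)\}$. $L^2(g)$ is the space of Borel functions $F:\mathbb{R}^n\to\mathbb{R}^d$ with $\int_{\mathbb{R}^n}\|F(x)\|_{g(x)}^2\,dx<+\infty$. If $\int_{\mathbb{R}^n}|g|<+\infty$ and $F\in L^2(g)$, the vector $\int_{\mathbb{R}^n}g(x)F(x)\,dx\in\mathbb{R}^d$ is well defined. For differentiable $F:\mathbb{R}^n\to\mathbb{R}^d$, $\nabla_xF:=[\partial_{x_1}F(x),\dots,\partial_{x_n}F(x)]\in\mathcal{M}_{d,n}(\mathbb{R})$. *)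

theory Defs
  imports "HOL-Analysis.Analysis"
begin

definition sym_posdef :: "(real^'d^'d) set" where
  "sym_posdef = {h. transpose h = h \<and> (\<forall>u. u \<noteq> 0 \<longrightarrow> (h *v u) \<bullet> u > 0)}"

definition wnorm :: "real^'d^'d \<Rightarrow> real^'d \<Rightarrow> real" where
  "wnorm h u = sqrt ((h *v u) \<bullet> u)"

text \<open>A \<open>d \<times> n\<close> matrix has type \<open>real^'n^'d\<close>, so that \<open>column k U\<close> is a vector of
  \<open>real^'d\<close> for each \<open>k :: 'n\<close>.\<close>

definition wmat_inner :: "real^'d^'d \<Rightarrow> real^'n^'d \<Rightarrow> real^'n^'d \<Rightarrow> real" where
  "wmat_inner h U V = (\<Sum>k\<in>UNIV. (h *v column k U) \<bullet> column k V)"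

definition C1_fun :: "('a::real_normed_vector \<Rightarrow> 'b::real_normed_vector) \<Rightarrow> bool" where
  "C1_fun f \<longleftrightarrow> (\<exists>f' :: 'a \<Rightarrow> 'a \<Rightarrow>\<^sub>L 'b.
     (\<forall>x. (f has_derivative blinfun_apply (f' x)) (at x)) \<and> continuous_on UNIV f')"

definition C2_fun :: "('a::real_normed_vector \<Rightarrow> 'b::real_normed_vector) \<Rightarrow> bool" where
  "C2_fun f \<longleftrightarrow> (\<exists>f' :: 'a \<Rightarrow> 'a \<Rightarrow>\<^sub>L 'b.
     (\<forall>x. (f has_derivative blinfun_apply (f' x)) (at x)) \<and> C1_fun f')"

definition partial_deriv :: "'n \<Rightarrow> (real^'n \<Rightarrow> 'b::real_normed_vector) \<Rightarrow> real^'n \<Rightarrow> 'b" where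
  "partial_deriv k f x = vector_derivative (\<lambda>t. f (x + t *\<^sub>R axis k 1)) (at 0)"

definition grad_mat :: "(real^'n \<Rightarrow> real^'d) \<Rightarrow> real^'n \<Rightarrow> real^'n^'d" where
  "grad_mat F x = (\<chi> i k. partial_deriv k F x $ i)"

definition theta :: "(real^'n \<Rightarrow> real^'d^'d) \<Rightarrow> 'n \<Rightarrow> 'n \<Rightarrow> real^'n \<Rightarrow> real^'d^'d" where
  "theta g j k x = partial_deriv k (\<lambda>y. matrix_inv (g y) ** partial_deriv j g y) x"

definition Theta :: "(real^'n \<Rightarrow> real^'d^'d) \<Rightarrow> real^'n \<Rightarrow> real^'n^'d \<Rightarrow> real^'n^'d" where
  "Theta g x U = (\<chi> i k. (\<Sum>j\<in>UNIV. theta g j k x *v column j U) $ i)"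

lemma column_Theta: "column k (Theta g x U) = (\<Sum>j\<in>UNIV. theta g j k x *v column j U)"
  by (simp add: vec_eq_iff column_def Theta_def)

lemma linear_Theta: "linear (Theta g x)"
proof (rule linearI)
  have add: "column j (U + V) = column j U + column j V"
    and scale: "column j (c *\<^sub>R U) = c *\<^sub>R column j U" for j :: 'a and U V :: "real^'a^'b" and c
    by (simp_all add: vec_eq_iff column_def)
  show "Theta g x (U + V) = Theta g x U + Theta g x V" for U V
    by (simp add: vec_eq_iff Theta_def add matrix_vector_right_distrib sum.distrib)
  show "Theta g x (c *\<^sub>R U) = c *\<^sub>R Theta g x U" for c U
    by (simp add: vec_eq_iff Theta_def scale matrix_vector_mult_scaleR sum_distrib_left)
qed

definition N_log_concave :: "(real^'n \<Rightarrow> real^'d^'d) \<Rightarrow> bool" where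
  "N_log_concave g \<longleftrightarrow> range g \<subseteq> sym_posdef \<and> C2_fun g \<and>
     (\<forall>x U. wmat_inner (g x) (Theta g x U) U \<le> 0)"

definition polar :: "('e \<Rightarrow> 'e \<Rightarrow> real) \<Rightarrow> ('e \<Rightarrow> real) \<Rightarrow> 'e \<Rightarrow> ennreal" where
  "polar ip Q v = (SUP u\<in>{u. Q u \<le> 1}. ennreal ((ip u v)\<^sup>2))"

definition weighted_L2 :: "(real^'n \<Rightarrow> real^'d^'d) \<Rightarrow> (real^'n \<Rightarrow> real^'d) set" where
  "weighted_L2 g = {F \<in> borel_measurable borel.
     (\<integral>\<^sup>+x. ennreal ((wnorm (g x) (F x))\<^sup>2) \<partial>lborel) < \<infinity>}"

end

theory Submission
  imports Defs
begin

text \<open>Let \<open>B\<close> be a cube, \<open>c\<close> the mean of \<open>F\<close> over \<open>B\<close> for the weight \<open>g\<close>, and \<open>h = F - c\<close>. Suppose that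
vector fields \<open>u\<^sub>1, \<dots>, u\<^sub>n\<close> solve \<open>\<Sum>\<^sub>k \<partial>\<^sub>k (g u\<^sub>k) = g h\<close> on \<open>B\<close>, with \<open>u\<^sub>k = 0\<close> on the two faces on
which \<open>x\<^sub>k\<close> is extremal. Integrating \<open>\<integral>\<langle>g h | h\<rangle>\<close> by parts gives \<open>- \<Sum>\<^sub>k \<integral>\<langle>g u\<^sub>k | \<partial>\<^sub>k F\<rangle>\<close>. Now insert
\<open>h = \<Sum>\<^sub>j (\<partial>\<^sub>j u\<^sub>j + g\<^sup>-\<^sup>1 (\<partial>\<^sub>j g) u\<^sub>j)\<close> for \<open>F\<close>: the derivative \<open>\<partial>\<^sub>k\<close> of \<open>g\<^sup>-\<^sup>1 \<partial>\<^sub>j g\<close> produces \<open>\<theta>\<^sub>j\<^sub>k\<close>, and a second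
integration by parts yields
\<open>\<integral>\<langle>g h | h\<rangle> = \<integral> Q(U) + \<Sum>\<^sub>j\<^sub>k \<integral>\<langle>\<partial>\<^sub>j u\<^sub>k | g \<partial>\<^sub>k u\<^sub>j\<rangle>\<close>.

The mixed terms have no sign in general. But the divergence equation is underdetermined, and it has a
solution that is triangular, as in Knothe's transport map: \<open>u\<^sub>k\<close> depends on the first \<open>k\<close> coordinates only
(\<open>triangular_solution\<close>). For \<open>j \<noteq> k\<close> one of \<open>\<partial>\<^sub>j u\<^sub>k\<close>, \<open>\<partial>\<^sub>k u\<^sub>j\<close> is then zero, while the diagonal terms are
nonnegative, so that \<open>\<integral> Q(U) \<le> \<integral>\<langle>g h | h\<rangle>\<close>. With \<open>W = - U\<close> this says
\<open>\<integral>\<langle>g h | h\<rangle> \<le> \<integral> (2 \<langle>W | \<nabla>F\<rangle> - Q(W))\<close> (\<open>cube_certificate\<close>), and the integrand on the right is at most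
the polar form \<open>Q\<degree>(\<nabla>F)\<close> (\<open>le_polar\<close>). When \<open>\<Theta>\<close> is bijective it is also at most
\<open>\<langle>(- \<Theta>)\<^sup>-\<^sup>1 \<nabla>F | \<nabla>F\<rangle>\<close>, by completing the square for the symmetric form \<open>Q\<close> (\<open>le_inverse_form\<close>,
\<open>Theta_symmetric\<close>). The triangular solution is explicit: each \<open>u\<^sub>k\<close> is the product of the inverse of a partial
marginal of \<open>g\<close> and a primitive in one variable.

Finally the cube grows to the whole space. The mean over the cube minimises the weighted square
distance on it, so only a correction that tends to zero separates the bound on the cubes from the
bound for the global mean (\<open>variance_le_of_cubes\<close>). The right-hand sides are reached by
monotonicity of the integral alone, since on each cube they are compared with a continuous minorant.\<close>

section \<open>Partial derivatives\<close>

text \<open>Derivatives along the coordinate axes are easy to integrate, and to exchange with integrals in the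
other coordinates. The derivative is an explicit argument because \<open>partial_deriv\<close> is a total function
whose value does not express differentiability.\<close>

definition has_partial :: "'n::finite \<Rightarrow> (real^'n \<Rightarrow> 'b::real_normed_vector) \<Rightarrow> (real^'n \<Rightarrow> 'b) \<Rightarrow> bool" where
  "has_partial k f f' \<longleftrightarrow> (\<forall>x. ((\<lambda>t. f (x + t *\<^sub>R axis k 1)) has_vector_derivative f' x) (at 0))"

lemma has_partial_unique:
  assumes "has_partial k f f1" "has_partial k f f2" shows "f1 = f2"
proof
  fix x
  from assms show "f1 x = f2 x"
    unfolding has_partial_def by (blast intro: vector_derivative_unique_at)
qed

lemma partial_deriv_eq: "has_partial k f f' \<Longrightarrow> partial_deriv k f = f'"
  unfolding has_partial_def partial_deriv_def by (auto intro!: vector_derivative_at)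

lemma has_partial_line:
  assumes "has_partial k f f'"
  shows "((\<lambda>t. f (x + t *\<^sub>R axis k 1)) has_vector_derivative f' (x + t *\<^sub>R axis k 1)) (at t)"
proof -
  have "((\<lambda>s. f ((x + t *\<^sub>R axis k 1) + s *\<^sub>R axis k 1)) has_vector_derivative f' (x + t *\<^sub>R axis k 1)) (at 0)"
    using assms unfolding has_partial_def by blast
  then have "(((\<lambda>s. f ((x + t *\<^sub>R axis k 1) + s *\<^sub>R axis k 1)) \<circ> (\<lambda>s. s - t)) has_vector_derivative 1 *\<^sub>R f' (x + t *\<^sub>R axis k 1)) (at t)"
    by (intro vector_diff_chain_at) (auto intro!: derivative_eq_intros simp flip: has_real_derivative_iff_has_vector_derivative)
  moreover have "((\<lambda>s. f ((x + t *\<^sub>R axis k 1) + s *\<^sub>R axis k 1)) \<circ> (\<lambda>s. s - t)) = (\<lambda>t. f (x + t *\<^sub>R axis k 1))"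
    by (auto simp: fun_eq_iff algebra_simps)
  ultimately show ?thesis by simp
qed

lemma has_partial_const: "has_partial k (\<lambda>x. c) (\<lambda>x. 0)"
  unfolding has_partial_def by auto

lemma has_partial_add: "has_partial k f f' \<Longrightarrow> has_partial k h h' \<Longrightarrow> has_partial k (\<lambda>x. f x + h x) (\<lambda>x. f' x + h' x)"
  unfolding has_partial_def by (simp add: has_vector_derivative_add)

lemma has_partial_diff: "has_partial k f f' \<Longrightarrow> has_partial k h h' \<Longrightarrow> has_partial k (\<lambda>x. f x - h x) (\<lambda>x. f' x - h' x)"
  unfolding has_partial_def by (simp add: has_vector_derivative_diff)

lemma has_partial_minus: "has_partial k f f' \<Longrightarrow> has_partial k (\<lambda>x. - f x) (\<lambda>x. - f' x)"
  unfolding has_partial_def by (simp add: has_vector_derivative_minus)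

lemma has_partial_sum: "(\<And>i. i \<in> S \<Longrightarrow> has_partial k (f i) (f' i)) \<Longrightarrow> has_partial k (\<lambda>x. \<Sum>i\<in>S. f i x) (\<lambda>x. \<Sum>i\<in>S. f' i x)"
  unfolding has_partial_def by (simp add: has_vector_derivative_sum)

lemma has_partial_bilinear:
  assumes "bounded_bilinear B" "has_partial k f f'" "has_partial k h h'"
  shows "has_partial k (\<lambda>x. B (f x) (h x)) (\<lambda>x. B (f x) (h' x) + B (f' x) (h x))"
  unfolding has_partial_def
proof
  fix x
  show "((\<lambda>t. B (f (x + t *\<^sub>R axis k 1)) (h (x + t *\<^sub>R axis k 1))) has_vector_derivative
         B (f x) (h' x) + B (f' x) (h x)) (at 0)"
    using bounded_bilinear.has_vector_derivative[OF assms(1), of "\<lambda>t. f (x + t *\<^sub>R axis k 1)" "f' x" 0 UNIV "\<lambda>t. h (x + t *\<^sub>R axis k 1)" "h' x"]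
      assms(2,3) unfolding has_partial_def by simp
qed

lemma has_partial_linear:
  assumes "bounded_linear L" "has_partial k f f'"
  shows "has_partial k (\<lambda>x. L (f x)) (\<lambda>x. L (f' x))"
  using assms unfolding has_partial_def by (auto intro: bounded_linear.has_vector_derivative)

definition has_C1 :: "(real^'n \<Rightarrow> 'b::real_normed_vector) \<Rightarrow> ('n::finite \<Rightarrow> real^'n \<Rightarrow> 'b) \<Rightarrow> bool" where
  "has_C1 f f1 \<longleftrightarrow> continuous_on UNIV f \<and> (\<forall>k. has_partial k f (f1 k) \<and> continuous_on UNIV (f1 k))"

text \<open>The regularity of the triangular solution: \<open>u\<^sub>j\<close> inherits only one derivative from \<open>F\<close>, but it gains one
in the direction \<open>j\<close> in which it was integrated. The functions \<open>f2 k\<close> are the common values of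
\<open>\<partial>\<^sub>k \<partial>\<^sub>j f\<close> and \<open>\<partial>\<^sub>j \<partial>\<^sub>k f\<close>. The class is closed under products and matrix inversion, and a \<open>C\<^sup>2\<close>
function belongs to it for every \<open>j\<close>.\<close>

definition has_C1_along :: "'n::finite \<Rightarrow> (real^'n \<Rightarrow> 'b::real_normed_vector) \<Rightarrow> ('n \<Rightarrow> real^'n \<Rightarrow> 'b) \<Rightarrow> ('n \<Rightarrow> real^'n \<Rightarrow> 'b) \<Rightarrow> bool" where
  "has_C1_along j f f1 f2 \<longleftrightarrow> has_C1 f f1 \<and> has_C1 (f1 j) f2 \<and> (\<forall>k. has_partial j (f1 k) (f2 k))"

lemma has_C1D:
  assumes "has_C1 f f1"
  shows "continuous_on UNIV f" "has_partial k f (f1 k)" "continuous_on UNIV (f1 k)"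
  using assms by (auto simp: has_C1_def)

lemma has_C1_alongD:
  assumes "has_C1_along j f f1 f2"
  shows "has_C1 f f1" "has_C1 (f1 j) f2" "has_partial j (f1 k) (f2 k)"
  using assms by (auto simp: has_C1_along_def)

lemma has_C1_bilinear:
  assumes B: "bounded_bilinear B" and "has_C1 f f1" "has_C1 h h1"
  shows "has_C1 (\<lambda>x. B (f x) (h x)) (\<lambda>k x. B (f x) (h1 k x) + B (f1 k x) (h x))"
  using assms(2,3) unfolding has_C1_def
  by (auto intro!: has_partial_bilinear B continuous_intros bounded_bilinear.continuous_on[OF B])

lemma has_C1_add: "has_C1 f f1 \<Longrightarrow> has_C1 h h1 \<Longrightarrow> has_C1 (\<lambda>x. f x + h x) (\<lambda>k x. f1 k x + h1 k x)"
  unfolding has_C1_def by (auto intro!: has_partial_add continuous_intros)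

lemma has_C1_diff: "has_C1 f f1 \<Longrightarrow> has_C1 h h1 \<Longrightarrow> has_C1 (\<lambda>x. f x - h x) (\<lambda>k x. f1 k x - h1 k x)"
  unfolding has_C1_def by (auto intro!: has_partial_diff continuous_intros)

lemma has_C1_minus: "has_C1 f f1 \<Longrightarrow> has_C1 (\<lambda>x. - f x) (\<lambda>k x. - f1 k x)"
  unfolding has_C1_def by (auto intro!: has_partial_minus continuous_intros)

lemma has_C1_linear:
  assumes L: "bounded_linear L" and f: "has_C1 f f1"
  shows "has_C1 (\<lambda>x. L (f x)) (\<lambda>k x. L (f1 k x))"
  using f unfolding has_C1_def
  by (auto intro: has_partial_linear[OF L] bounded_linear.continuous_on[OF L])

lemma has_C1_along_bilinear:
  assumes B: "bounded_bilinear B" and f: "has_C1_along j f f1 f2" and h: "has_C1_along j h h1 h2"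
  shows "has_C1_along j (\<lambda>x. B (f x) (h x)) (\<lambda>k x. B (f x) (h1 k x) + B (f1 k x) (h x))
     (\<lambda>k x. B (f x) (h2 k x) + B (f1 k x) (h1 j x) + (B (f1 j x) (h1 k x) + B (f2 k x) (h x)))"
  unfolding has_C1_along_def
proof (intro conjI allI)
  show "has_C1 (\<lambda>x. B (f x) (h x)) (\<lambda>k x. B (f x) (h1 k x) + B (f1 k x) (h x))"
    using f h by (intro has_C1_bilinear B) (auto simp: has_C1_along_def)
  show "has_C1 (\<lambda>x. B (f x) (h1 j x) + B (f1 j x) (h x))
     (\<lambda>k x. B (f x) (h2 k x) + B (f1 k x) (h1 j x) + (B (f1 j x) (h1 k x) + B (f2 k x) (h x)))"
    using f h by (intro has_C1_bilinear has_C1_add B) (auto simp: has_C1_along_def)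
  fix k
  have "has_partial j (\<lambda>x. B (f x) (h1 k x) + B (f1 k x) (h x))
     (\<lambda>x. (B (f x) (h2 k x) + B (f1 j x) (h1 k x)) + (B (f1 k x) (h1 j x) + B (f2 k x) (h x)))"
    using f h by (intro has_partial_bilinear has_partial_add B) (auto simp: has_C1_along_def has_C1_def)
  then show "has_partial j (\<lambda>x. B (f x) (h1 k x) + B (f1 k x) (h x))
     (\<lambda>x. B (f x) (h2 k x) + B (f1 k x) (h1 j x) + (B (f1 j x) (h1 k x) + B (f2 k x) (h x)))"
    by (simp add: algebra_simps)
qed

section \<open>Positive definite matrices and matrix inversion\<close>

lemma bounded_bilinear_matrix_vector: "bounded_bilinear ((*v) :: real^'n^'m \<Rightarrow> real^'n \<Rightarrow> real^'m)"
  unfolding bilinear_conv_bounded_bilinear[symmetric] bilinear_def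
  by (auto intro!: linearI simp: matrix_vector_mult_add_rdistrib matrix_vector_right_distrib
      scaleR_matrix_vector_assoc matrix_vector_mult_scaleR)

lemma bounded_bilinear_matrix_mult: "bounded_bilinear ((**) :: real^'n^'m \<Rightarrow> real^'p^'n \<Rightarrow> real^'p^'m)"
  unfolding bilinear_conv_bounded_bilinear[symmetric] bilinear_def
  by (auto intro!: linearI simp: matrix_matrix_mult_def vec_eq_iff sum.distrib distrib_left distrib_right
      sum_distrib_left mult_ac)

lemma bounded_linear_transpose: "bounded_linear (transpose :: real^'n^'m \<Rightarrow> real^'m^'n)"
  unfolding linear_conv_bounded_linear[symmetric] by (auto intro!: linearI simp: transpose_def vec_eq_iff)

lemma matrix_inv_mult:
  fixes A :: "real^'d^'d"
  assumes "invertible A"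
  shows "A ** matrix_inv A = mat 1" "matrix_inv A ** A = mat 1"
  using someI_ex[of "\<lambda>A'. A ** A' = mat 1 \<and> A' ** A = mat 1"] assms
  unfolding invertible_def matrix_inv_def by auto

lemma matrix_inv_vector_mult:
  fixes A :: "real^'d^'d"
  assumes "invertible A"
  shows "A *v (matrix_inv A *v x) = x" "matrix_inv A *v (A *v x) = x"
  by (simp_all add: matrix_vector_mul_assoc matrix_inv_mult assms)

lemma sym_posdef_inner: "h \<in> sym_posdef \<Longrightarrow> (h *v u) \<bullet> v = u \<bullet> (h *v v)"
  unfolding sym_posdef_def by (metis (mono_tags, lifting) dot_lmul_matrix mem_Collect_eq transpose_matrix_vector)

lemma sym_posdef_pos: "h \<in> sym_posdef \<Longrightarrow> u \<noteq> 0 \<Longrightarrow> (h *v u) \<bullet> u > 0"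
  unfolding sym_posdef_def by auto

lemma sym_posdef_nonneg: "h \<in> sym_posdef \<Longrightarrow> (h *v u) \<bullet> u \<ge> 0"
  by (cases "u = 0") (auto intro: less_imp_le sym_posdef_pos)

lemma sym_posdef_invertible:
  assumes "h \<in> sym_posdef" shows "invertible h"
proof -
  have "inj ((*v) h)"
  proof (rule injI)
    fix x y assume "h *v x = h *v y"
    then have "(h *v (x - y)) \<bullet> (x - y) = 0" by (simp add: matrix_vector_mult_diff_distrib)
    then show "x = y" using sym_posdef_pos[OF assms, of "x - y"] by force
  qed
  then show ?thesis
    by (simp add: invertible_left_inverse matrix_left_invertible_injective)
qed

text \<open>By Cramer's rule the entries of the inverse are quotients of polynomials in the entries.\<close>

lemma continuous_on_matrix_inv:
  fixes G :: "'a::topological_space \<Rightarrow> real^'d^'d"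
  assumes c: "continuous_on S G" and inv: "\<And>x. x \<in> S \<Longrightarrow> invertible (G x)"
  shows "continuous_on S (\<lambda>x. matrix_inv (G x))"
proof -
  have e: "matrix_inv (G x) = (\<chi> k j. det(\<chi> i l. if l=k then axis j 1 $ i else G x $i$l) / det (G x))" if "x \<in> S" for x
  proof -
    have "matrix_inv (G x) *v axis j 1 = (\<chi> k. det(\<chi> i l. if l=k then axis j 1 $ i else G x $i$l) / det (G x))" for j
      using cramer[of "G x" "matrix_inv (G x) *v axis j 1" "axis j 1"] inv[OF that]
      by (simp add: invertible_det_nz[symmetric] matrix_inv_vector_mult)
    then show ?thesis
      by (simp add: vec_eq_iff matrix_vector_mul_component inner_axis flip: column_def)
  qed
  have d: "continuous_on S (\<lambda>x. det (M x))" if "\<And>i l. continuous_on S (\<lambda>x. M x $ i $ l)" for M :: "'a \<Rightarrow> real^'d^'d"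
    unfolding det_def by (intro continuous_intros that)
  have "continuous_on S (\<lambda>x. (\<chi> k j. det(\<chi> i l. if l=k then axis j 1 $ i else G x $i$l) / det (G x)) :: real^'d^'d)"
  proof (intro continuous_on_vec_lambda continuous_on_divide d ballI)
    fix i l k j show "continuous_on S (\<lambda>x. (\<chi> i l. if l = k then axis j 1 $ i else G x $ i $ l) $ i $ l)"
      by (cases "l = k") (auto intro!: continuous_intros c)
  qed (use inv in \<open>auto intro!: continuous_intros c simp: invertible_det_nz\<close>)
  then show ?thesis by (subst continuous_on_cong[OF refl e]) auto
qed

lemmas matvec_lin = bounded_bilinear.add_left[OF bounded_bilinear_matrix_vector] bounded_bilinear.add_right[OF bounded_bilinear_matrix_vector]
 bounded_bilinear.diff_left[OF bounded_bilinear_matrix_vector] bounded_bilinear.diff_right[OF bounded_bilinear_matrix_vector]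
 bounded_bilinear.minus_left[OF bounded_bilinear_matrix_vector] bounded_bilinear.minus_right[OF bounded_bilinear_matrix_vector]
 bounded_bilinear.zero_left[OF bounded_bilinear_matrix_vector] bounded_bilinear.zero_right[OF bounded_bilinear_matrix_vector]
 bounded_bilinear.scaleR_left[OF bounded_bilinear_matrix_vector] bounded_bilinear.scaleR_right[OF bounded_bilinear_matrix_vector]
 bounded_bilinear.sum_left[OF bounded_bilinear_matrix_vector] bounded_bilinear.sum_right[OF bounded_bilinear_matrix_vector]

lemmas matmul_lin = bounded_bilinear.add_left[OF bounded_bilinear_matrix_mult] bounded_bilinear.add_right[OF bounded_bilinear_matrix_mult]
 bounded_bilinear.diff_left[OF bounded_bilinear_matrix_mult] bounded_bilinear.diff_right[OF bounded_bilinear_matrix_mult]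
 bounded_bilinear.minus_left[OF bounded_bilinear_matrix_mult] bounded_bilinear.minus_right[OF bounded_bilinear_matrix_mult]
 bounded_bilinear.scaleR_left[OF bounded_bilinear_matrix_mult] bounded_bilinear.scaleR_right[OF bounded_bilinear_matrix_mult]

lemma has_vector_derivative_iff_quotient:
  fixes f :: "real \<Rightarrow> 'b::real_normed_vector"
  shows "(f has_vector_derivative D) (at 0) \<longleftrightarrow> ((\<lambda>h. (f h - f 0) /\<^sub>R h) \<longlongrightarrow> D) (at 0)"
proof -
  have eq: "norm ((f h - f 0) /\<^sub>R h - D) = norm (f (0 + h) - f 0 - h *\<^sub>R D) / norm h" if "h \<noteq> 0" for h
  proof -
    have "(f h - f 0) /\<^sub>R h - D = (f (0 + h) - f 0 - h *\<^sub>R D) /\<^sub>R h"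
      using that by (simp add: scaleR_diff_right)
    then show ?thesis by (simp add: divide_inverse_commute)
  qed
  have "((\<lambda>h. (f h - f 0) /\<^sub>R h) \<longlongrightarrow> D) (at 0) \<longleftrightarrow> ((\<lambda>h. norm ((f h - f 0) /\<^sub>R h - D)) \<longlongrightarrow> 0) (at 0)"
    by (simp add: LIM_zero_iff tendsto_norm_zero_iff)
  also have "\<dots> \<longleftrightarrow> ((\<lambda>h. norm (f (0 + h) - f 0 - h *\<^sub>R D) / norm h) \<longlongrightarrow> 0) (at 0)"
    by (intro tendsto_cong) (simp add: eventually_at_filter eq)
  finally show ?thesis
    by (simp add: has_vector_derivative_def has_derivative_at bounded_linear_scaleR_left)
qed

text \<open>The resolvent identity \<open>A\<^sup>-\<^sup>1 - B\<^sup>-\<^sup>1 = - A\<^sup>-\<^sup>1 (A - B) B\<^sup>-\<^sup>1\<close> turns continuity of the inverse into differentiability.\<close>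

lemma has_partial_matrix_inv:
  fixes G :: "real^'n \<Rightarrow> real^'d^'d"
  assumes c: "continuous_on UNIV G" and inv: "\<And>x. invertible (G x)" and d: "has_partial k G G1"
  shows "has_partial k (\<lambda>x. matrix_inv (G x)) (\<lambda>x. - (matrix_inv (G x) ** (G1 x ** matrix_inv (G x))))"
  unfolding has_partial_def
proof
  fix x
  let ?m = "\<lambda>t. matrix_inv (G (x + t *\<^sub>R axis k 1))"
  let ?G = "\<lambda>t. G (x + t *\<^sub>R axis k 1)"
  have cm: "continuous_on UNIV ?m"
    by (intro continuous_on_matrix_inv inv continuous_on_compose2[OF c] continuous_intros) auto
  then have "isCont ?m 0" by (simp add: continuous_on_eq_continuous_at)
  then have "(?m \<longlongrightarrow> ?m 0) (at 0)" by (rule isContD)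
  moreover have "((\<lambda>h. (?G h - ?G 0) /\<^sub>R h) \<longlongrightarrow> G1 x) (at 0)"
    using d unfolding has_partial_def has_vector_derivative_iff_quotient by blast
  ultimately have "((\<lambda>h. - (?m h ** (((?G h - ?G 0) /\<^sub>R h) ** ?m 0))) \<longlongrightarrow> - (?m 0 ** (G1 x ** ?m 0))) (at 0)"
    by (intro tendsto_minus bounded_bilinear.tendsto[OF bounded_bilinear_matrix_mult] tendsto_const)
  moreover have "- (?m h ** (((?G h - ?G 0) /\<^sub>R h) ** ?m 0)) = (?m h - ?m 0) /\<^sub>R h" for h
  proof -
    have "?m h ** ((?G h - ?G 0) ** ?m 0) = (?m h ** ?G h) ** ?m 0 - ?m h ** (?G 0 ** ?m 0)"
      by (simp only: matmul_lin matrix_mul_assoc)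
    also have "\<dots> = ?m 0 - ?m h"
      by (simp only: matrix_inv_mult inv matrix_mul_lid matrix_mul_rid)
    finally have e: "?m h ** ((?G h - ?G 0) ** ?m 0) = ?m 0 - ?m h" .
    have "- (?m h ** (((?G h - ?G 0) /\<^sub>R h) ** ?m 0)) = - ((?m h ** ((?G h - ?G 0) ** ?m 0)) /\<^sub>R h)"
      by (simp only: matmul_lin)
    then show ?thesis by (simp only: e) (simp flip: scaleR_minus_right)
  qed
  ultimately show "(?m has_vector_derivative - (matrix_inv (G x) ** (G1 x ** matrix_inv (G x)))) (at 0)"
    unfolding has_vector_derivative_iff_quotient by simp
qed

lemma has_C1_matrix_inv:
  fixes G :: "real^'n \<Rightarrow> real^'d^'d"
  assumes G: "has_C1 G G1" and inv: "\<And>x. invertible (G x)"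
  shows "has_C1 (\<lambda>x. matrix_inv (G x)) (\<lambda>k x. - (matrix_inv (G x) ** (G1 k x ** matrix_inv (G x))))"
  unfolding has_C1_def
proof (intro conjI allI)
  show c: "continuous_on UNIV (\<lambda>x. matrix_inv (G x))"
    using G by (intro continuous_on_matrix_inv inv) (auto simp: has_C1_def)
  show "has_partial k (\<lambda>x. matrix_inv (G x)) (\<lambda>x. - (matrix_inv (G x) ** (G1 k x ** matrix_inv (G x))))" for k
    using G by (intro has_partial_matrix_inv inv) (auto simp: has_C1_def)
  show "continuous_on UNIV (\<lambda>x. - (matrix_inv (G x) ** (G1 k x ** matrix_inv (G x))))" for k
    using G by (intro continuous_intros bounded_bilinear.continuous_on[OF bounded_bilinear_matrix_mult] c) (auto simp: has_C1_def)
qed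

text \<open>Both orders of differentiation lead to
\<open>m G\<^sub>j m G\<^sub>k m + m G\<^sub>k m G\<^sub>j m - m G\<^sub>j\<^sub>k m\<close> with \<open>m = G\<^sup>-\<^sup>1\<close>, which is symmetric in \<open>j\<close> and \<open>k\<close>.\<close>

lemma has_C1_along_matrix_inv:
  fixes G :: "real^'n \<Rightarrow> real^'d^'d"
  assumes G: "has_C1_along j G G1 G2" and inv: "\<And>x. invertible (G x)"
  shows "\<exists>m1 m2. has_C1_along j (\<lambda>x. matrix_inv (G x)) m1 m2"
proof -
  define m where "m x = matrix_inv (G x)" for x
  define m1 where "m1 k x = - (m x ** (G1 k x ** m x))" for k x
  define m2 where "m2 k x = - (m x ** (G1 j x ** m1 k x + G2 k x ** m x) + m1 k x ** (G1 j x ** m x))" for k x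
  have C: "has_C1 m m1" using has_C1_matrix_inv[of G G1] G inv unfolding m_def m1_def has_C1_along_def by auto
  have m1f: "m1 k = (\<lambda>x. - (m x ** (G1 k x ** m x)))" for k by (rule ext) (simp add: m1_def)
  have C2: "has_C1 (m1 j) m2"
    unfolding m1f[of j] m2_def using G C
    by (intro has_C1_minus has_C1_bilinear bounded_bilinear_matrix_mult) (auto simp: has_C1_along_def)
  have "has_partial j (m1 k) (m2 k)" for k
  proof -
    have "has_partial j (m1 k) (\<lambda>x. - (m x ** (G1 k x ** m1 j x + G2 k x ** m x) + m1 j x ** (G1 k x ** m x)))"
      unfolding m1f[of k] using G C
      by (intro has_partial_minus has_partial_bilinear bounded_bilinear_matrix_mult) (auto simp: has_C1_along_def has_C1_def)
    moreover have "(\<lambda>x. - (m x ** (G1 k x ** m1 j x + G2 k x ** m x) + m1 j x ** (G1 k x ** m x))) = m2 k"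
      by (simp add: m2_def m1_def fun_eq_iff matmul_lin matrix_mul_assoc)
    ultimately show ?thesis by simp
  qed
  with C C2 show ?thesis unfolding has_C1_along_def m_def by blast
qed

section \<open>Primitives in one coordinate\<close>

text \<open>The integral of \<open>\<phi>\<close> from \<open>a\<close> to \<open>\<tau>\<close> is written over the fixed interval \<open>{0..1}\<close>. It then has the correct sign
for \<open>\<tau> < a\<close> as well, so that primitives are differentiable on the whole space and not just to the right of \<open>a\<close>,
and differentiation under the integral sign meets no moving end point.\<close>

lemma primitive_has_vector_derivative:
  fixes \<phi> :: "real \<Rightarrow> 'b::banach"
  assumes c: "continuous_on UNIV \<phi>"
  shows "((\<lambda>\<tau>. (\<tau> - a) *\<^sub>R integral {0..1} (\<lambda>s. \<phi> (a + s * (\<tau> - a)))) has_vector_derivative \<phi> T) (at T)"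
proof -
  define M where "M = \<bar>T\<bar> + \<bar>a\<bar> + 1"
  define \<Phi> where "\<Phi> \<tau> = integral {-M..\<tau>} \<phi>" for \<tau>
  have D: "(\<Phi> has_vector_derivative \<phi> \<tau>) (at \<tau>)" if "-M < \<tau>" "\<tau> < M" for \<tau>
  proof -
    have "(\<Phi> has_vector_derivative \<phi> \<tau>) (at \<tau> within {-M..M})"
      unfolding \<Phi>_def using that by (intro integral_has_vector_derivative continuous_on_subset[OF c]) auto
    then show ?thesis using that by (simp add: at_within_Icc_at)
  qed
  have eq: "(\<tau> - a) *\<^sub>R integral {0..1} (\<lambda>s. \<phi> (a + s * (\<tau> - a))) = \<Phi> \<tau> - \<Phi> a" if t: "\<tau> \<in> {-M<..<M}" for \<tau>
  proof -
    have "((\<lambda>s. (\<tau> - a) *\<^sub>R \<phi> (a + s * (\<tau> - a))) has_integral (\<Phi> (a + 1 * (\<tau> - a)) - \<Phi> (a + 0 * (\<tau> - a)))) {0..1}"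
    proof (rule fundamental_theorem_of_calculus)
      fix s :: real assume s: "s \<in> {0..1}"
      have am: "-M < a" "a < M" unfolding M_def by auto
      have "a + s * (\<tau> - a) = (1-s) * a + s * \<tau>" by (simp add: algebra_simps)
      moreover have "(1-s) * a + s * \<tau> \<in> {-M<..<M}"
        using s am t convexD[of "{-M<..<M}" a \<tau> "1-s" s] by auto
      ultimately have m: "-M < a + s * (\<tau> - a)" "a + s * (\<tau> - a) < M" by auto
      have "((\<Phi> \<circ> (\<lambda>s. a + s * (\<tau> - a))) has_vector_derivative (\<tau> - a) *\<^sub>R \<phi> (a + s * (\<tau> - a))) (at s within {0..1})"
        by (intro vector_diff_chain_within has_vector_derivative_at_within[OF D[OF m]])
           (auto intro!: derivative_eq_intros simp: has_real_derivative_iff_has_vector_derivative[symmetric])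
      then show "((\<lambda>s. \<Phi> (a + s * (\<tau> - a))) has_vector_derivative (\<tau> - a) *\<^sub>R \<phi> (a + s * (\<tau> - a))) (at s within {0..1})"
        by (simp add: o_def)
    qed simp
    then show ?thesis by (simp add: integral_unique flip: integral_cmul)
  qed
  \<comment> \<open>Both end points lie in \<open>{-M<..<M}\<close>, where \<open>\<Phi>\<close> is differentiable on both sides.\<close>
  have "((\<lambda>\<tau>. \<Phi> \<tau> - \<Phi> a) has_vector_derivative \<phi> T - 0) (at T)"
    by (intro derivative_intros D) (auto simp: M_def)
  then have "((\<lambda>\<tau>. \<Phi> \<tau> - \<Phi> a) has_vector_derivative \<phi> T) (at T)" by simp
  then show ?thesis
    by (rule has_vector_derivative_transform_within_open[where S="{-M<..<M}"])
       (auto simp: eq, auto simp: M_def)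
qed

definition prim :: "real \<Rightarrow> 'n::finite \<Rightarrow> (real^'n \<Rightarrow> 'b::banach) \<Rightarrow> real^'n \<Rightarrow> 'b" where
  "prim a k f x = (x$k - a) *\<^sub>R integral {0..1} (\<lambda>s. f (x + ((s - 1) * (x$k - a)) *\<^sub>R axis k 1))"

lemma has_partial_prim_same:
  assumes c: "continuous_on UNIV f"
  shows "has_partial k (prim a k f) f"
  unfolding has_partial_def
proof
  fix x
  define \<phi> where "\<phi> t = f (x + (t - x$k) *\<^sub>R axis k 1)" for t
  have "continuous_on UNIV \<phi>" unfolding \<phi>_def
    by (intro continuous_intros continuous_on_compose2[OF c]) auto
  from primitive_has_vector_derivative[OF this, of a "x$k"]
  have "(((\<lambda>\<tau>. (\<tau> - a) *\<^sub>R integral {0..1} (\<lambda>s. \<phi> (a + s * (\<tau> - a)))) \<circ> (\<lambda>t. x$k + t)) has_vector_derivative 1 *\<^sub>R \<phi> (x$k)) (at 0)"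
    by (intro vector_diff_chain_at) (auto intro!: derivative_eq_intros)
  moreover have "(\<lambda>t. prim a k f (x + t *\<^sub>R axis k 1)) = (\<lambda>\<tau>. (\<tau> - a) *\<^sub>R integral {0..1} (\<lambda>s. \<phi> (a + s * (\<tau> - a)))) \<circ> (\<lambda>t. x$k + t)"
    by (auto simp: fun_eq_iff prim_def \<phi>_def algebra_simps axis_def)
  ultimately show "((\<lambda>t. prim a k f (x + t *\<^sub>R axis k 1)) has_vector_derivative f x) (at 0)"
    by (simp add: \<phi>_def)
qed

lemma continuous_on_prim:
  assumes c: "continuous_on UNIV f"
  shows "continuous_on UNIV (prim a k f)"
proof -
  have "continuous_on UNIV (\<lambda>x. integral (cbox 0 1) (\<lambda>s. f (x + ((s - 1) * (x$k - a)) *\<^sub>R axis k 1)))"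
    by (intro integral_continuous_on_param) (auto simp: split_beta intro!: continuous_intros continuous_on_compose2[OF c])
  then show ?thesis unfolding prim_def[abs_def] by (auto intro!: continuous_intros)
qed

lemma has_partial_prim_other:
  assumes c: "continuous_on UNIV f" and c': "continuous_on UNIV f'" and d: "has_partial j f f'" and jk: "j \<noteq> k"
  shows "has_partial j (prim a k f) (prim a k f')"
  unfolding has_partial_def
proof
  fix x
  have "((\<lambda>t. integral (cbox 0 1) (\<lambda>s. f (x + ((s - 1) * (x$k - a)) *\<^sub>R axis k 1 + t *\<^sub>R axis j 1)))
     has_vector_derivative integral (cbox 0 1) (\<lambda>s. f' (x + ((s - 1) * (x$k - a)) *\<^sub>R axis k 1 + 0 *\<^sub>R axis j 1))) (at 0 within UNIV)"
    by (rule leibniz_rule_vector_derivative)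
     (auto simp: split_beta intro!: has_partial_line d integrable_continuous_real continuous_intros continuous_on_compose2[OF c] continuous_on_compose2[OF c'])
  then show "((\<lambda>t. prim a k f (x + t *\<^sub>R axis j 1)) has_vector_derivative prim a k f' x) (at 0)"
    using jk by (auto simp: prim_def axis_def add_ac intro!: derivative_eq_intros)
qed

definition upd :: "real^'n \<Rightarrow> 'n \<Rightarrow> real \<Rightarrow> real^'n" where
  "upd x k t = x + (t - x$k) *\<^sub>R axis k 1"

lemma upd_nth: "upd x k t $ i = (if i = k then t else x $ i)"
  by (auto simp: upd_def axis_def)

lemma upd_upd: "upd (upd x k s) k t = upd x k t"
  by (simp add: vec_eq_iff upd_nth)

lemma upd_shift_same: "upd (x + t *\<^sub>R axis k 1) k s = upd x k s"
  by (simp add: vec_eq_iff upd_nth axis_def)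

lemma upd_shift_other: "j \<noteq> k \<Longrightarrow> upd (x + t *\<^sub>R axis j 1) k s = upd x k s + t *\<^sub>R axis j 1"
  by (simp add: vec_eq_iff upd_nth axis_def)

lemma continuous_on_upd: "continuous_on S (\<lambda>x. upd x k t)"
  unfolding upd_def by (intro continuous_intros)

lemma prim_upd: "prim a k f x = (x$k - a) *\<^sub>R integral {0..1} (\<lambda>s. f (upd x k (a + s * (x$k - a))))"
  unfolding prim_def upd_def by (simp add: algebra_simps)

lemma has_partial_upd_other:
  assumes "has_partial j f f'" "j \<noteq> k"
  shows "has_partial j (\<lambda>x. f (upd x k s)) (\<lambda>x. f' (upd x k s))"
  using assms unfolding has_partial_def by (simp add: upd_shift_other)

lemma has_partial_upd_same: "has_partial k (\<lambda>x. f (upd x k s)) (\<lambda>x. 0)"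
  unfolding has_partial_def by (simp add: upd_shift_same)

lemma has_partial_indep:
  assumes "\<And>x t. f (upd x j t) = f x" shows "has_partial j f (\<lambda>x. 0)"
proof -
  have "f (x + t *\<^sub>R axis j 1) = f x" for x t
    using assms[of x "x$j + t"] by (simp add: upd_def)
  then show ?thesis unfolding has_partial_def by simp
qed

lemma has_partial_zero_upd:
  fixes f :: "real^'n \<Rightarrow> 'b::real_normed_vector"
  assumes "has_partial k f (\<lambda>x. 0)" shows "f (upd x k t) = f x"
proof -
  have "((\<lambda>t. f (x + t *\<^sub>R axis k 1)) has_derivative (\<lambda>h. 0)) (at s within UNIV)" for s
    using has_partial_line[OF assms, of x s] by (simp add: has_vector_derivative_def)
  then have "\<exists>c. \<forall>s\<in>UNIV. f (x + s *\<^sub>R axis k 1) = c"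
    by (intro has_derivative_zero_constant) auto
  then obtain c where "\<And>s. f (x + s *\<^sub>R axis k 1) = c" by auto
  from this[of "t - x$k"] this[of 0] show ?thesis by (simp add: upd_def)
qed

text \<open>The fundamental theorem of calculus along a coordinate line, in the form that can be differentiated in the other coordinates.\<close>

lemma prim_recover:
  fixes f :: "real^'n \<Rightarrow> 'b::euclidean_space"
  assumes "has_partial k f f'" "continuous_on UNIV f'"
  shows "f x = f (upd x k a) + prim a k f' x"
proof -
  have "has_partial k (\<lambda>x. f x - prim a k f' x) (\<lambda>x. f' x - f' x)"
    by (intro has_partial_diff assms has_partial_prim_same)
  then have "has_partial k (\<lambda>x. f x - prim a k f' x) (\<lambda>x. 0)" by simp
  from has_partial_zero_upd[OF this, of x a]
  show ?thesis by (simp add: prim_def upd_nth algebra_simps)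
qed

text \<open>Schwarz's theorem, with the existence of \<open>\<partial>\<^sub>j \<partial>\<^sub>k f\<close> as part of the conclusion: write \<open>f\<close> as its restriction to
\<open>x\<^sub>j = 0\<close> plus the primitive of \<open>\<partial>\<^sub>j f\<close>, apply \<open>\<partial>\<^sub>k\<close> under the integral, and then \<open>\<partial>\<^sub>j\<close>, which cancels the
primitive and kills the restriction.\<close>

lemma has_partial_commute:
  fixes f :: "real^'n \<Rightarrow> 'b::euclidean_space"
  assumes f: "has_C1 f f1" and fj: "has_C1 (f1 j) f2"
  shows "has_partial j (f1 k) (f2 k)"
proof (cases "j = k")
  case True then show ?thesis using fj by (auto simp: has_C1_def)
next
  case False
  have "has_partial k (\<lambda>x. f (upd x j 0) + prim 0 j (f1 j) x) (\<lambda>x. f1 k (upd x j 0) + prim 0 j (f2 k) x)"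
    using f fj False by (intro has_partial_add has_partial_upd_other has_partial_prim_other) (auto simp: has_C1_def)
  moreover have "f = (\<lambda>x. f (upd x j 0) + prim 0 j (f1 j) x)"
    using f by (intro ext prim_recover) (auto simp: has_C1_def)
  ultimately have e: "f1 k = (\<lambda>x. f1 k (upd x j 0) + prim 0 j (f2 k) x)"
    using f has_partial_unique unfolding has_C1_def by (metis (no_types, lifting))
  have "has_partial j (\<lambda>x. f1 k (upd x j 0) + prim 0 j (f2 k) x) (\<lambda>x. 0 + f2 k x)"
    using fj by (intro has_partial_add has_partial_upd_same has_partial_prim_same) (auto simp: has_C1_def)
  then show ?thesis by (subst e) simp
qed

lemma has_C1_along_intro:
  fixes f :: "real^'n \<Rightarrow> 'b::euclidean_space"
  assumes "has_C1 f f1" "has_C1 (f1 j) f2" shows "has_C1_along j f f1 f2"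
  using assms has_partial_commute[OF assms] unfolding has_C1_along_def by blast

text \<open>Integration in direction \<open>k\<close> is what gains the derivative in that direction.\<close>

lemma has_C1_along_prim:
  assumes f: "has_C1 f f1"
  shows "has_C1_along k (prim a k f) (\<lambda>j. if j = k then f else prim a k (f1 j)) f1"
  using f unfolding has_C1_along_def has_C1_def
  by (simp add: has_partial_prim_same has_partial_prim_other continuous_on_prim)

section \<open>Iterated integrals over some of the coordinates\<close>

text \<open>The integral over \<open>x\<^sub>k \<in> {a..b}\<close>, kept as a function on the whole space that is constant in \<open>x\<^sub>k\<close>. Thus
marginals in any number of variables have the same type, which the induction over the coordinates requires.\<close>

definition slice :: "real \<Rightarrow> real \<Rightarrow> 'n::finite \<Rightarrow> (real^'n \<Rightarrow> 'b::banach) \<Rightarrow> real^'n \<Rightarrow> 'b" where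
  "slice a b k f x = prim a k f (upd x k b)"

fun slices :: "real \<Rightarrow> real \<Rightarrow> 'n::finite list \<Rightarrow> (real^'n \<Rightarrow> 'b::banach) \<Rightarrow> real^'n \<Rightarrow> 'b" where
  "slices a b [] f = f"
| "slices a b (k # ks) f = slice a b k (slices a b ks f)"

lemma slice_eq: "slice a b k f x = (b - a) *\<^sub>R integral {0..1} (\<lambda>s. f (upd x k (a + s * (b - a))))"
  by (simp add: slice_def prim_upd upd_nth upd_upd)

lemma continuous_on_slice: "continuous_on UNIV f \<Longrightarrow> continuous_on UNIV (slice a b k f)"
  unfolding slice_def[abs_def] by (intro continuous_on_compose2[OF continuous_on_prim] continuous_on_upd) auto

lemma continuous_on_slices: "continuous_on UNIV f \<Longrightarrow> continuous_on UNIV (slices a b ks f)"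
  by (induction ks) (auto intro: continuous_on_slice)

lemma has_C1_slice:
  assumes "has_C1 f f1"
  shows "has_C1 (slice a b k f) (\<lambda>j. if j = k then (\<lambda>x. 0) else slice a b k (f1 j))"
  unfolding has_C1_def
proof (intro conjI allI)
  note f = assms[unfolded has_C1_def]
  show "continuous_on UNIV (slice a b k f)" using f by (simp add: continuous_on_slice)
  show "continuous_on UNIV (if j = k then \<lambda>x. 0 else slice a b k (f1 j))" for j
    using f by (simp add: continuous_on_slice)
  show "has_partial j (slice a b k f) (if j = k then \<lambda>x. 0 else slice a b k (f1 j))" for j
  proof (cases "j = k")
    case True
    then show ?thesis using has_partial_upd_same[of k "prim a k f" b] by (simp add: slice_def[abs_def])
  next
    case False
    then have "has_partial j (prim a k f) (prim a k (f1 j))"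
      using f by (intro has_partial_prim_other) auto
    from has_partial_upd_other[OF this False, of b] False show ?thesis by (simp add: slice_def[abs_def])
  qed
qed

lemma has_C1_slices:
  assumes "has_C1 f f1"
  shows "has_C1 (slices a b ks f) (\<lambda>j. if j \<in> set ks then (\<lambda>x. 0) else slices a b ks (f1 j))"
proof (induction ks)
  case Nil then show ?case using assms by simp
next
  case (Cons k ks)
  have z: "slice a b k (\<lambda>x. 0) = (\<lambda>x. 0)" by (simp add: slice_eq fun_eq_iff)
  have e: "(\<lambda>j. if j = k then (\<lambda>x. 0) else slice a b k (if j \<in> set ks then (\<lambda>x. 0) else slices a b ks (f1 j)))
     = (\<lambda>j. if j \<in> set (k # ks) then (\<lambda>x. 0) else slices a b (k # ks) (f1 j))"
    by (auto simp: fun_eq_iff z)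
  from has_C1_slice[OF Cons, of a b k] show ?case unfolding e by simp
qed

lemma has_C1_along_slices:
  fixes f :: "real^'n \<Rightarrow> 'b::euclidean_space"
  assumes f: "has_C1_along i f f1 f2" and i: "i \<notin> set ks"
  shows "\<exists>s2. has_C1_along i (slices a b ks f) (\<lambda>j. if j \<in> set ks then (\<lambda>x. 0) else slices a b ks (f1 j)) s2"
proof -
  have "has_C1 f f1" "has_C1 (f1 i) f2" using f by (auto simp: has_C1_along_def)
  from has_C1_slices[OF this(1), of a b ks] has_C1_slices[OF this(2), of a b ks] i
  show ?thesis by (intro exI[of _ "\<lambda>j. if j \<in> set ks then (\<lambda>x. 0) else slices a b ks (f2 j)"] has_C1_along_intro) simp_all
qed

lemma continuous_on_upd_line:
  "continuous_on UNIV f \<Longrightarrow> continuous_on S (\<lambda>s. f (upd x k (a + s * (b - a))))"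
  by (erule continuous_on_compose2) (auto simp: upd_def intro!: continuous_intros)

lemma slice_linear:
  assumes L: "bounded_linear L" and c: "continuous_on UNIV f"
  shows "slice a b k (\<lambda>x. L (f x)) x = L (slice a b k f x)"
proof -
  have "integral {0..1} (\<lambda>s. L (f (upd x k (a + s * (b - a))))) = L (integral {0..1} (\<lambda>s. f (upd x k (a + s * (b - a)))))"
    using integral_linear[OF integrable_continuous_real[OF continuous_on_upd_line[OF c, of "{0..1}" x k a b]] L]
    by (simp add: o_def)
  then show ?thesis by (simp add: slice_eq linear_simps[OF L])
qed

lemma slices_linear:
  assumes L: "bounded_linear L" and c: "continuous_on UNIV f"
  shows "slices a b ks (\<lambda>x. L (f x)) = (\<lambda>x. L (slices a b ks f x))"
proof (induction ks)
  case (Cons k ks)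
  then show ?case by (simp add: slice_linear[OF L continuous_on_slices[OF c], abs_def])
qed simp

lemma slices_cong_on:
  assumes "\<And>i. i \<notin> set ks \<Longrightarrow> x$i = y$i"
  shows "slices a b ks f x = slices a b ks f y"
  using assms
proof (induction ks arbitrary: x y)
  case Nil
  then have "x = y" by (simp add: vec_eq_iff)
  then show ?case by simp
next
  case (Cons k ks)
  have "slices a b ks f (upd x k t) = slices a b ks f (upd y k t)" for t
    using Cons.prems by (intro Cons.IH) (auto simp: upd_nth)
  then show ?case by (simp add: slice_eq)
qed

lemma slices_diff:
  assumes c: "continuous_on UNIV f" and d: "continuous_on UNIV h"
  shows "slices a b ks (\<lambda>x. f x - h x) = (\<lambda>x. slices a b ks f x - slices a b ks h x)"
proof (induction ks)
  case (Cons k ks)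
  have "integral {0..1} (\<lambda>s. slices a b ks f (upd x k (a + s * (b - a))) - slices a b ks h (upd x k (a + s * (b - a))))
    = integral {0..1} (\<lambda>s. slices a b ks f (upd x k (a + s * (b - a)))) - integral {0..1} (\<lambda>s. slices a b ks h (upd x k (a + s * (b - a))))" for x
    by (intro integral_diff integrable_continuous_real continuous_on_upd_line continuous_on_slices c d)
  then show ?case
    by (simp add: fun_eq_iff Cons slice_eq scaleR_diff_right)
qed simp

lemma slices_bilinear_indep:
  assumes B: "bounded_bilinear B" and c: "continuous_on UNIV f"
    and w: "\<And>x k t. k \<in> set ks \<Longrightarrow> w (upd x k t) = w x"
  shows "slices a b ks (\<lambda>x. B (f x) (w x)) = (\<lambda>x. B (slices a b ks f x) (w x))"
  using w
proof (induction ks)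
  case (Cons k ks)
  have IH: "slices a b ks (\<lambda>x. B (f x) (w x)) = (\<lambda>x. B (slices a b ks f x) (w x))"
    using Cons by auto
  have "slice a b k (\<lambda>x. B (slices a b ks f x) (w x)) x = slice a b k (\<lambda>y. B (slices a b ks f y) (w x)) x" for x
    using Cons.prems by (simp add: slice_eq)
  also have "\<dots> x = B (slice a b k (slices a b ks f) x) (w x)" for x
    by (rule slice_linear[OF bounded_bilinear.bounded_linear_left[OF B] continuous_on_slices[OF c]])
  finally show ?case by (simp add: IH fun_eq_iff)
qed simp

lemma slice_pos:
  fixes f :: "real^'n \<Rightarrow> real"
  assumes c: "continuous_on UNIV f" and p: "\<And>x. f x > 0" and ab: "a < b"
  shows "slice a b k f x > 0"
proof -
  let ?\<phi> = "\<lambda>s. f (upd x k (a + s * (b - a)))"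
  have co: "continuous_on {0..1} ?\<phi>" by (rule continuous_on_upd_line[OF c])
  obtain s0 where s0: "s0 \<in> {0..1}" "\<And>s. s \<in> {0..1} \<Longrightarrow> ?\<phi> s0 \<le> ?\<phi> s"
    using continuous_attains_inf[OF _ _ co] by auto
  have "integral {0..1} (\<lambda>s::real. ?\<phi> s0) \<le> integral {0..1} ?\<phi>"
    by (rule integral_le) (use s0 in \<open>auto intro!: integrable_continuous_real co\<close>)
  then have "0 < integral {0..1} ?\<phi>" using p[of "upd x k (a + s0 * (b - a))"] by simp
  then show ?thesis using ab by (simp add: slice_eq)
qed

lemma slices_pos:
  fixes f :: "real^'n \<Rightarrow> real"
  assumes c: "continuous_on UNIV f" and p: "\<And>x. f x > 0" and ab: "a < b"
  shows "slices a b ks f x > 0"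
proof (induction ks arbitrary: x)
  case (Cons k ks)
  show ?case using slice_pos[OF continuous_on_slices[OF c] Cons ab] by simp
qed (simp add: p)

lemma slices_sym_posdef:
  fixes g :: "real^'n \<Rightarrow> real^'d^'d"
  assumes c: "continuous_on UNIV g" and p: "\<And>x. g x \<in> sym_posdef" and ab: "a < b"
  shows "slices a b ks g x \<in> sym_posdef"
proof -
  have "bounded_linear (transpose :: real^'d^'d \<Rightarrow> real^'d^'d)"
    by (rule bounded_linear_transpose)
  from slices_linear[OF this c, of a b ks]
  have "slices a b ks (\<lambda>x. transpose (g x)) x = transpose (slices a b ks g x)" by simp
  moreover have "(\<lambda>x. transpose (g x)) = g" using p by (auto simp: sym_posdef_def)
  ultimately have "transpose (slices a b ks g x) = slices a b ks g x" by simp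
  moreover have "(slices a b ks g x *v u) \<bullet> u > 0" if "u \<noteq> 0" for u
  proof -
    have "bounded_linear (\<lambda>A::real^'d^'d. (A *v u) \<bullet> u)"
      by (intro bounded_linear_inner_left_comp bounded_bilinear.bounded_linear_left[OF bounded_bilinear_matrix_vector])
    from slices_linear[OF this c, of a b ks]
    have e: "(slices a b ks g x *v u) \<bullet> u = slices a b ks (\<lambda>x. (g x *v u) \<bullet> u) x" by simp
    show ?thesis unfolding e
      by (intro slices_pos sym_posdef_pos p that ab continuous_on_inner continuous_on_const
         bounded_bilinear.continuous_on[OF bounded_bilinear_matrix_vector] c)
  qed
  ultimately show ?thesis by (simp add: sym_posdef_def)
qed

section \<open>The triangular solution of the divergence equation\<close>

text \<open>Coordinates are treated one at a time. The hypothesis says that \<open>g h\<close> has integral zero over the coordinates in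
\<open>ks\<close>, the others being parameters. With \<open>k\<close> the first coordinate and \<open>G\<close>, \<open>H\<close> the integrals of \<open>g\<close>, \<open>g h\<close>
over the remaining ones, \<open>u\<^sub>k = G\<^sup>-\<^sup>1 \<integral>\<^sub>a H dx\<^sub>k\<close> does not depend on the remaining coordinates, and
\<open>\<partial>\<^sub>k (g u\<^sub>k)\<close> has the same integral over them as \<open>g h\<close>. So the remainder
\<open>h - g\<^sup>-\<^sup>1 \<partial>\<^sub>k (g u\<^sub>k)\<close> satisfies the hypothesis for the remaining coordinates. It is again only \<open>C\<^sup>1\<close>, which is
why the derivative gained by \<open>\<partial>\<^sub>k u\<^sub>k\<close> is essential. Parameters have to be kept differentiable, since
derivatives of \<open>u\<^sub>j\<close> in earlier coordinates occur in the mixed terms.\<close>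

lemma triangular_solution:
  fixes g :: "real^'n \<Rightarrow> real^'d^'d" and h :: "real^'n \<Rightarrow> real^'d"
  assumes g: "\<And>j. has_C1_along j g g1 (g2 j)" and pd: "\<And>x. g x \<in> sym_posdef" and ab: "a < b"
    and "distinct ks" and "has_C1 h h1" and "\<And>x. slices a b ks (\<lambda>x. g x *v h x) x = 0"
  shows "\<exists>u u1 u2.
    (\<forall>k\<in>set ks. has_C1_along k (u k) (u1 k) (u2 k) \<and> (\<forall>x. x$k = a \<or> x$k = b \<longrightarrow> u k x = 0)) \<and>
    (\<forall>j\<in>set ks. \<forall>k\<in>set ks. j \<noteq> k \<longrightarrow> (\<forall>x. u1 j k x = 0) \<or> (\<forall>x. u1 k j x = 0)) \<and>
    (\<forall>x. (\<Sum>k\<in>set ks. g x *v u1 k k x + g1 k x *v u k x) = g x *v h x)"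
  using assms(4-)
proof (induction ks arbitrary: h h1)
  case Nil
  then show ?case by simp
next
  case (Cons k ks)
  note mv = bounded_bilinear_matrix_vector
  have k: "k \<notin> set ks" "distinct ks" using Cons.prems by auto
  have gC1: "has_C1 g g1" using has_C1_alongD(1)[OF g] .
  have gC: "continuous_on UNIV g" using has_C1D(1)[OF gC1] .
  define G where "G = slices a b ks g"
  define H where "H = slices a b ks (\<lambda>x. g x *v h x)"
  define P where "P = prim a k H"
  have Gpd: "G x \<in> sym_posdef" for x unfolding G_def by (rule slices_sym_posdef[OF gC pd ab])
  have Ginv: "invertible (G x)" for x using sym_posdef_invertible[OF Gpd] .
  have ginv: "invertible (g x)" for x using sym_posdef_invertible[OF pd] .
  obtain G1 G2 where GA: "has_C1_along k G G1 G2"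
    using has_C1_along_slices[OF g k(1)] unfolding G_def by blast
  obtain m1 m2 where mA: "has_C1_along k (\<lambda>x. matrix_inv (G x)) m1 m2"
    using has_C1_along_matrix_inv[OF GA Ginv] by blast
  have ghC1: "has_C1 (\<lambda>x. g x *v h x) (\<lambda>k x. g x *v h1 k x + g1 k x *v h x)"
    by (rule has_C1_bilinear[OF mv gC1 Cons.prems(2)])
  obtain H1 where HC1: "has_C1 H H1"
    using has_C1_slices[OF ghC1] unfolding H_def by blast
  define U where "U x = matrix_inv (G x) *v P x" for x
  have "\<exists>U1 U2. has_C1_along k U U1 U2"
    unfolding U_def P_def using has_C1_along_bilinear[OF mv mA has_C1_along_prim[OF HC1]] by blast
  then obtain U1 U2 where UA: "has_C1_along k U U1 U2" by blast
  have GU: "G x *v U x = P x" for x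
    unfolding U_def by (simp add: matrix_inv_vector_mult Ginv)
  \<comment> \<open>At \<open>x\<^sub>k = b\<close> this is the vanishing of the full integral of \<open>g h\<close>.\<close>
  have U0: "U x = 0" if x: "x$k = a \<or> x$k = b" for x
  proof -
    have "P x = 0"
    proof (cases "x$k = a")
      case True then show ?thesis by (simp add: P_def prim_def)
    next
      case False
      then have "upd x k b = x" using x by (simp add: upd_def)
      then show ?thesis using Cons.prems(3)[of x] by (simp add: slice_def P_def H_def)
    qed
    then show ?thesis by (simp add: U_def)
  qed
  have Uind: "U (upd x j t) = U x" if j: "j \<in> set ks" for x j t
  proof -
    have "G (upd x j t) = G x" unfolding G_def
      by (rule slices_cong_on) (use j in \<open>auto simp: upd_nth\<close>)
    moreover have "H (upd (upd x j t) k s) = H (upd x k s)" for s unfolding H_def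
      by (rule slices_cong_on) (use j in \<open>auto simp: upd_nth\<close>)
    moreover have "upd x j t $ k = x $ k" using j k by (auto simp: upd_nth)
    ultimately show ?thesis unfolding U_def P_def prim_upd by simp
  qed
  \<comment> \<open>Triangularity: the later coordinates have been integrated out.\<close>
  have U1z: "U1 j x = 0" if j: "j \<in> set ks" for j x
    using has_partial_unique[OF has_C1D(2)[OF has_C1_alongD(1)[OF UA]] has_partial_indep[OF Uind[OF j]]]
    by (simp add: fun_eq_iff)
  \<comment> \<open>\<open>V\<close> is \<open>\<partial>\<^sub>k (g U)\<close>; in that form it is visibly \<open>C\<^sup>1\<close>.\<close>
  define V where "V x = g x *v U1 k x + g1 k x *v U x" for x
  have VC1: "\<exists>V1. has_C1 V V1"
    unfolding V_def using has_C1_add[OF has_C1_bilinear[OF mv gC1 has_C1_alongD(2)[OF UA]]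
       has_C1_bilinear[OF mv has_C1_alongD(2)[OF g[of k]] has_C1_alongD(1)[OF UA]]] by blast
  then obtain V1 where VC1: "has_C1 V V1" by blast
  have SV: "slices a b ks V = H"
  proof -
    have "has_C1 (\<lambda>x. g x *v U x) (\<lambda>k x. g x *v U1 k x + g1 k x *v U x)"
      by (rule has_C1_bilinear[OF mv gC1 has_C1_alongD(1)[OF UA]])
    from has_C1D(2)[OF has_C1_slices[OF this], of k a b ks] k
    have "has_partial k (slices a b ks (\<lambda>x. g x *v U x)) (slices a b ks V)"
      by (simp add: V_def[abs_def])
    moreover have "slices a b ks (\<lambda>x. g x *v U x) = P"
      by (subst slices_bilinear_indep[OF mv gC Uind]) (auto simp: GU[unfolded G_def])
    moreover have "has_partial k P H"
      unfolding P_def by (rule has_partial_prim_same[OF has_C1D(1)[OF HC1]])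
    ultimately show ?thesis using has_partial_unique by metis
  qed
  define h' where "h' x = h x - matrix_inv (g x) *v V x" for x
  obtain h1' where h'C1: "has_C1 h' h1'"
    unfolding h'_def using has_C1_diff[OF Cons.prems(2) has_C1_bilinear[OF mv has_C1_matrix_inv[OF gC1 ginv] VC1]] by blast
  have gh': "g x *v h' x = g x *v h x - V x" for x
    by (simp add: h'_def matvec_lin matrix_inv_vector_mult ginv)
  have "slices a b ks (\<lambda>x. g x *v h' x) x = 0" for x
    unfolding gh' slices_diff[OF has_C1D(1)[OF ghC1] has_C1D(1)[OF VC1]] SV
    by (simp add: H_def)
  note ex = Cons.IH[OF k(2) h'C1 this]
  obtain u u1 u2 where IH: "(\<forall>k\<in>set ks. has_C1_along k (u k) (u1 k) (u2 k) \<and> (\<forall>x. x$k = a \<or> x$k = b \<longrightarrow> u k x = 0)) \<and>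
    (\<forall>j\<in>set ks. \<forall>k\<in>set ks. j \<noteq> k \<longrightarrow> (\<forall>x. u1 j k x = 0) \<or> (\<forall>x. u1 k j x = 0)) \<and>
    (\<forall>x. (\<Sum>k\<in>set ks. g x *v u1 k k x + g1 k x *v u k x) = g x *v h' x)"
    using ex by (elim exE) (rule that)
  have IH1: "has_C1_along i (u i) (u1 i) (u2 i)" if "i \<in> set ks" for i
    using conjunct1[OF IH] that by blast
  have IH2: "u i x = 0" if "i \<in> set ks" "x$i = a \<or> x$i = b" for i x
    using conjunct1[OF IH] that by blast
  have IH3: "(\<forall>x. u1 i j x = 0) \<or> (\<forall>x. u1 j i x = 0)" if "i \<in> set ks" "j \<in> set ks" "i \<noteq> j" for i j
    using conjunct1[OF conjunct2[OF IH]] that by blast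
  have IH4: "(\<Sum>k\<in>set ks. g x *v u1 k k x + g1 k x *v u k x) = g x *v h' x" for x
    using IH by simp
  let ?u = "u(k := U)" and ?u1 = "u1(k := U1)" and ?u2 = "u2(k := U2)"
  have sum: "(\<Sum>i\<in>set (k # ks). g x *v ?u1 i i x + g1 i x *v ?u i x) = g x *v h x" for x
  proof -
    have "(\<Sum>i\<in>set ks. g x *v ?u1 i i x + g1 i x *v ?u i x) = (\<Sum>i\<in>set ks. g x *v u1 i i x + g1 i x *v u i x)"
      by (rule sum.cong) (use k in auto)
    then show ?thesis using k by (simp add: IH4 gh' V_def)
  qed
  show ?case
  proof (rule exI[of _ ?u], rule exI[of _ ?u1], rule exI[of _ ?u2], intro conjI ballI allI impI)
    fix i x assume i: "i \<in> set (k # ks)"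
    show "has_C1_along i (?u i) (?u1 i) (?u2 i)"
      using i UA IH1 by (cases "i = k") simp_all
    show "?u i x = 0" if "x$i = a \<or> x$i = b"
      using i U0 IH2 that by (cases "i = k") simp_all
  next
    fix x show "(\<Sum>i\<in>set (k # ks). g x *v ?u1 i i x + g1 i x *v ?u i x) = g x *v h x" by (rule sum)
  next
    fix i j assume i: "i \<in> set (k # ks)" and j: "j \<in> set (k # ks)" and ne: "i \<noteq> j"
    show "(\<forall>x. ?u1 i j x = 0) \<or> (\<forall>x. ?u1 j i x = 0)"
    proof (cases "i = k")
      case True then show ?thesis using j ne U1z by simp
    next
      case False
      then show ?thesis using i j ne U1z IH3[of i j] by (cases "j = k") simp_all
    qed
  qed
qed

section \<open>Integration by parts on a cube\<close>

definition cube :: "real \<Rightarrow> real \<Rightarrow> (real^'n) set" where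
  "cube a b = cbox (\<chi> i. a) (\<chi> i. b)"

lemma mem_cube: "x \<in> cube a b \<longleftrightarrow> (\<forall>i. a \<le> x$i \<and> x$i \<le> b)"
  by (simp add: cube_def mem_box_cart)

lemma compact_cube: "compact (cube a b)" by (simp add: cube_def)

lemma integrable_on_cube: "continuous_on UNIV f \<Longrightarrow> f integrable_on cube a b"
  for f :: "real^'n \<Rightarrow> real"
  unfolding cube_def by (rule integrable_continuous) (erule continuous_on_subset, simp)

lemma integrable_cube:
  fixes f :: "real^'n \<Rightarrow> real"
  assumes "continuous_on UNIV f"
  shows "integrable lborel (\<lambda>x. indicator (cube a b) x *\<^sub>R f x)"
  by (rule borel_integrable_compact[OF compact_cube continuous_on_subset[OF assms]]) simp

lemma integral_cube_eq_lborel: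
  fixes f :: "real^'n \<Rightarrow> real"
  assumes "continuous_on UNIV f"
  shows "integral (cube a b) f = (\<integral>x. indicator (cube a b) x *\<^sub>R f x \<partial>lborel)"
  using set_borel_integral_eq_integral(2)[of "cube a b" f] integrable_cube[OF assms, of a b]
  unfolding set_integrable_def set_lebesgue_integral_def by simp

text \<open>Fubini in the single coordinate \<open>k\<close>: on each line in direction \<open>k\<close> that meets the cube the integral is the difference
of the values of \<open>\<phi>\<close> on the two faces.\<close>

lemma integral_partial_eq_0:
  fixes \<phi> :: "real^'n \<Rightarrow> real"
  assumes d: "has_partial k \<phi> \<phi>'" and c': "continuous_on UNIV \<phi>'"
    and z: "\<And>x. x$k = a \<or> x$k = b \<Longrightarrow> \<phi> x = 0" and ab: "a \<le> b"
  shows "integral (cube a b) \<phi>' = 0"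
proof -
  let ?f = "\<lambda>x. indicator (cube a b) x *\<^sub>R \<phi>' x"
  let ?e = "axis k 1 :: real^'n"
  let ?I = "Basis - {?e}"
  let ?T = "\<lambda>y. \<Sum>v\<in>Basis. y v *\<^sub>R v :: real^'n"
  interpret product_sigma_finite "\<lambda>_::real^'n. lborel :: real measure"
    by standard
  have e: "?e \<in> Basis" by (simp add: axis_in_Basis_iff)
  then have B: "insert ?e ?I = Basis" by auto
  have fi: "integrable lborel ?f" by (rule integrable_cube[OF c'])
  then have fm: "?f \<in> borel_measurable borel" by (simp add: borel_measurable_integrable)
  have Tm: "?T \<in> measurable (\<Pi>\<^sub>M b\<in>Basis. lborel) borel" by measurable
  have "integrable (distr (\<Pi>\<^sub>M b\<in>Basis. lborel) borel ?T) ?f"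
    using fi by (subst lborel_eq[symmetric])
  then have Ti: "integrable (Pi\<^sub>M (insert ?e ?I) (\<lambda>_. lborel)) (\<lambda>y. ?f (?T y))"
    unfolding B by (rule integrable_distr[OF Tm])
  have "(\<integral>x. ?f x \<partial>lborel) = (\<integral>y. ?f (?T y) \<partial>Pi\<^sub>M (insert ?e ?I) (\<lambda>_. lborel))"
    unfolding B by (subst lborel_eq) (rule integral_distr[OF Tm fm])
  also have "\<dots> = (\<integral>y. (\<integral>t. ?f (?T (y(?e := t))) \<partial>lborel) \<partial>Pi\<^sub>M ?I (\<lambda>_. lborel))"
    by (rule product_integral_insert) (use Ti in auto)
  also have "\<dots> = (\<integral>y. 0 \<partial>Pi\<^sub>M ?I (\<lambda>_. lborel :: real measure))"
  proof (rule Bochner_Integration.integral_cong[OF refl])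
    fix y :: "real^'n \<Rightarrow> real"
    define w where "w = (\<Sum>v\<in>?I. y v *\<^sub>R v)"
    have T: "?T (y(?e := t)) = w + t *\<^sub>R ?e" for t
    proof -
      have "?T (y(?e := t)) = t *\<^sub>R ?e + (\<Sum>v\<in>?I. (y(?e := t)) v *\<^sub>R v)"
        by (subst sum.remove[OF finite_Basis e]) (simp only: fun_upd_same)
      also have "(\<Sum>v\<in>?I. (y(?e := t)) v *\<^sub>R v) = w"
        unfolding w_def by (rule sum.cong) auto
      finally show ?thesis by simp
    qed
    have wk: "w $ k = 0"
    proof -
      have "w \<bullet> ?e = (\<Sum>v\<in>?I. y v *\<^sub>R (v \<bullet> ?e))" unfolding w_def by (simp add: inner_sum_left)
      also have "\<dots> = 0" using e by (intro sum.neutral) (auto simp: inner_Basis)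
      finally show ?thesis by (simp add: inner_axis)
    qed
    define q where "q = (if \<forall>i. i \<noteq> k \<longrightarrow> a \<le> w$i \<and> w$i \<le> b then 1 else 0 :: real)"
    have ind: "indicator (cube a b) (w + t *\<^sub>R ?e) = q * indicator {a..b} t" for t
      using wk by (auto simp: q_def indicator_def mem_cube axis_def split: if_splits)
    have "(\<integral>t. ?f (?T (y(?e := t))) \<partial>lborel) = (\<integral>t. q *\<^sub>R (indicator {a..b} t *\<^sub>R \<phi>' (w + t *\<^sub>R ?e)) \<partial>lborel)"
      unfolding T ind by (simp only: scaleR_scaleR real_scaleR_def mult.assoc)
    also have "\<dots> = q *\<^sub>R (\<integral>t. indicator {a..b} t *\<^sub>R \<phi>' (w + t *\<^sub>R ?e) \<partial>lborel)" 
      by (rule integral_scaleR_right)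
    also have "(\<integral>t. indicator {a..b} t *\<^sub>R \<phi>' (w + t *\<^sub>R ?e) \<partial>lborel) = \<phi> (w + b *\<^sub>R ?e) - \<phi> (w + a *\<^sub>R ?e)"
      by (rule integral_FTC_atLeastAtMost[OF ab has_vector_derivative_at_within[OF has_partial_line[OF d]]])
         (auto intro!: continuous_on_compose2[OF c'] continuous_intros)
    also have "\<dots> = 0" using z wk by simp
    finally show "(\<integral>t. ?f (?T (y(?e := t))) \<partial>lborel) = 0" by simp
  qed
  finally show ?thesis by (simp add: integral_cube_eq_lborel[OF c'])
qed

section \<open>The inequality on a cube\<close>

text \<open>The dual form of the inequality on a cube, with the field \<open>w = - u\<close> from the triangular solution as
certificate. Stated with a continuous field, it can be combined with any pointwise upper bound for
\<open>2 \<langle>W | \<nabla>F\<rangle> - Q(W)\<close>.\<close>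

lemma cube_certificate:
  fixes g :: "real^'n \<Rightarrow> real^'d^'d" and F :: "real^'n \<Rightarrow> real^'d"
  assumes g: "\<And>j. has_C1_along j g g1 (g2 j)" and pd: "\<And>x. g x \<in> sym_posdef" and ab: "a < b"
    and F: "has_C1 F F1"
    and th: "\<And>j. has_C1 (\<lambda>x. matrix_inv (g x) ** g1 j x) (th j)"
  shows "\<exists>c w. (\<forall>k. continuous_on UNIV (w k)) \<and>
    integral (cube a b) (\<lambda>x. (g x *v (F x - c)) \<bullet> (F x - c)) \<le>
    integral (cube a b) (\<lambda>x. 2 * (\<Sum>k\<in>UNIV. (g x *v w k x) \<bullet> F1 k x)
       + (\<Sum>k\<in>UNIV. (g x *v (\<Sum>j\<in>UNIV. th j k x *v w j x)) \<bullet> w k x))"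
proof -
  note mv = bounded_bilinear_matrix_vector and ip = bounded_bilinear_inner
  have gC1: "has_C1 g g1" using has_C1_alongD(1)[OF g] .
  have gC: "continuous_on UNIV g" using has_C1D(1)[OF gC1] .
  have ginv: "invertible (g x)" for x using sym_posdef_invertible[OF pd] .
  obtain ks :: "'n list" where ks: "set ks = UNIV" "distinct ks"
    using finite_distinct_list[OF finite_class.finite_UNIV] by blast
  \<comment> \<open>The iterated integrals over all coordinates are constant; \<open>0\<close> is an arbitrary base point.\<close>
  define c where "c = matrix_inv (slices a b ks g 0) *v slices a b ks (\<lambda>x. g x *v F x) 0"
  define h where "h x = F x - c" for x
  have hC1: "has_C1 h F1"
    unfolding h_def using has_C1_diff[OF F, of "\<lambda>x. c" "\<lambda>k x. 0"] by (simp add: has_C1_def has_partial_const)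
  have gFC: "continuous_on UNIV (\<lambda>x. g x *v F x)"
    by (rule has_C1D(1)[OF has_C1_bilinear[OF mv gC1 F]])
  have gcC: "continuous_on UNIV (\<lambda>x. g x *v c)"
    by (intro bounded_bilinear.continuous_on[OF mv] gC continuous_on_const)
  have zero: "slices a b ks (\<lambda>x. g x *v h x) x = 0" for x
  proof -
    have "slices a b ks (\<lambda>x. g x *v h x) x = slices a b ks (\<lambda>x. g x *v h x) 0"
      by (rule slices_cong_on) (simp add: ks)
    also have "\<dots> = slices a b ks (\<lambda>x. g x *v F x) 0 - slices a b ks (\<lambda>x. g x *v c) 0"
      unfolding h_def matvec_lin slices_diff[OF gFC gcC] ..
    also have "slices a b ks (\<lambda>x. g x *v c) = (\<lambda>x. slices a b ks g x *v c)"
      by (rule slices_linear[OF bounded_bilinear.bounded_linear_left[OF mv] gC])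
    also have "slices a b ks g 0 *v c = slices a b ks (\<lambda>x. g x *v F x) 0"
      unfolding c_def by (rule matrix_inv_vector_mult(1)[OF sym_posdef_invertible[OF slices_sym_posdef[OF gC pd ab]]])
    finally show ?thesis by simp
  qed
  obtain u u1 u2 where sol: "(\<forall>k\<in>set ks. has_C1_along k (u k) (u1 k) (u2 k) \<and> (\<forall>x. x$k = a \<or> x$k = b \<longrightarrow> u k x = 0)) \<and>
    (\<forall>j\<in>set ks. \<forall>k\<in>set ks. j \<noteq> k \<longrightarrow> (\<forall>x. u1 j k x = 0) \<or> (\<forall>x. u1 k j x = 0)) \<and>
    (\<forall>x. (\<Sum>k\<in>set ks. g x *v u1 k k x + g1 k x *v u k x) = g x *v h x)"
    using triangular_solution[OF g pd ab ks(2) hC1 zero] by (elim exE) (rule that)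
  have uA: "has_C1_along k (u k) (u1 k) (u2 k)" for k
    using conjunct1[OF sol] ks by blast
  have uz: "u k x = 0" if "x$k = a \<or> x$k = b" for k x
    using conjunct1[OF sol] ks that by blast
  have tri: "(\<forall>x. u1 j k x = 0) \<or> (\<forall>x. u1 k j x = 0)" if "j \<noteq> k" for j k
    using conjunct1[OF conjunct2[OF sol]] ks that by blast
  have eqn: "(\<Sum>k\<in>UNIV. g x *v u1 k k x + g1 k x *v u k x) = g x *v h x" for x
    using sol ks by simp
  have uC1: "has_C1 (u k) (u1 k)" for k using has_C1_alongD(1)[OF uA] .
  define D where "D k x = g x *v u1 k k x + g1 k x *v u k x" for k x
  define A where "A j x = matrix_inv (g x) ** g1 j x" for j x
  have AC1: "has_C1 (A j) (th j)" for j using th[of j] unfolding A_def[abs_def] by simp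
  note cont = has_C1D(1)[OF uC1] has_C1D(3)[OF uC1] has_C1D(3)[OF has_C1_alongD(2)[OF uA]] gC has_C1D(3)[OF gC1]
     has_C1D(1)[OF hC1] has_C1D(3)[OF hC1] has_C1D(3)[OF AC1]
     bounded_bilinear.continuous_on[OF mv]

  have h_eq: "h = (\<lambda>x. \<Sum>j\<in>UNIV. u1 j j x + A j x *v u j x)"
  proof
    fix x
    have "h x = matrix_inv (g x) *v (g x *v h x)" by (simp add: matrix_inv_vector_mult ginv)
    also have "\<dots> = (\<Sum>j\<in>UNIV. matrix_inv (g x) *v (g x *v u1 j j x) + matrix_inv (g x) *v (g1 j x *v u j x))"
      by (simp only: matvec_lin flip: eqn)
    also have "\<dots> = (\<Sum>j\<in>UNIV. u1 j j x + A j x *v u j x)"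
      by (simp only: matrix_inv_vector_mult ginv) (simp only: matrix_vector_mul_assoc A_def)
    finally show "h x = (\<Sum>j\<in>UNIV. u1 j j x + A j x *v u j x)" .
  qed
  \<comment> \<open>The gradient of \<open>F\<close> expressed by the solution; this is where \<open>\<theta>\<^sub>j\<^sub>k\<close> appears.\<close>
  have F1_eq: "F1 k x = (\<Sum>j\<in>UNIV. u2 j k x + (A j x *v u1 j k x + th j k x *v u j x))" for k x
  proof -
    have "has_partial k h (\<lambda>x. \<Sum>j\<in>UNIV. u2 j k x + (A j x *v u1 j k x + th j k x *v u j x))"
      unfolding h_eq
      by (intro has_partial_sum has_partial_add has_partial_bilinear[OF mv]
          has_C1D(2)[OF has_C1_alongD(2)[OF uA]] has_C1D(2)[OF uC1] has_C1D(2)[OF AC1])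
    from has_partial_unique[OF has_C1D(2)[OF hC1] this] show ?thesis by simp
  qed
  have gA: "(g x *v v) \<bullet> (A j x *v w) = v \<bullet> (g1 j x *v w)" for x j v w
    unfolding sym_posdef_inner[OF pd] A_def
    by (simp add: matrix_inv_vector_mult ginv flip: matrix_vector_mul_assoc)

  \<comment> \<open>\<open>\<psi>\<close> is the potential of the second integration by parts, \<open>\<psi>'\<close> its derivative in direction \<open>j\<close>,
    and \<open>S\<close> the mixed terms that remain.\<close>
  define \<psi> where "\<psi> j k x = u k x \<bullet> (g x *v u1 j k x)" for j k x
  define \<psi>' where "\<psi>' j k x = u k x \<bullet> (g x *v u2 j k x + g1 j x *v u1 j k x) + u1 k j x \<bullet> (g x *v u1 j k x)" for j k x
  define S where "S j k x = u1 k j x \<bullet> (g x *v u1 j k x)" for j k x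
  define Q where "Q x = - (\<Sum>k\<in>UNIV. (g x *v (\<Sum>j\<in>UNIV. th j k x *v u j x)) \<bullet> u k x)" for x
  define L where "L x = (\<Sum>k\<in>UNIV. (g x *v u k x) \<bullet> F1 k x)" for x

  have \<psi>_der: "has_partial j (\<psi> j k) (\<psi>' j k)" for j k
    unfolding \<psi>_def[abs_def] \<psi>'_def[abs_def]
    by (intro has_partial_bilinear[OF ip] has_partial_bilinear[OF mv] has_C1D(2)[OF uC1] has_C1D(2)[OF gC1] has_C1_alongD(3)[OF uA])
  \<comment> \<open>On a face \<open>x\<^sub>j = a\<close> or \<open>x\<^sub>j = b\<close>, \<open>u\<^sub>j\<close> vanishes together with its tangential derivatives.\<close>
  have \<psi>_zero: "\<psi> j k x = 0" if x: "x$j = a \<or> x$j = b" for j k x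
  proof (cases "j = k")
    case True then show ?thesis using uz x by (simp add: \<psi>_def)
  next
    case False
    have "((\<lambda>t. u j (x + t *\<^sub>R axis k 1)) has_vector_derivative u1 j k x) (at 0)"
      using has_C1D(2)[OF uC1[of j], of k] by (simp add: has_partial_def)
    moreover have "(\<lambda>t. u j (x + t *\<^sub>R axis k 1)) = (\<lambda>t. 0)"
      using x False by (intro ext uz) (auto simp: axis_def)
    ultimately have "u1 j k x = 0"
      using vector_derivative_unique_at has_vector_derivative_const by metis
    then show ?thesis by (simp add: \<psi>_def)
  qed
  have \<psi>'_cont: "continuous_on UNIV (\<psi>' j k)" for j k
    unfolding \<psi>'_def[abs_def] by (intro continuous_on_add continuous_on_inner cont)
  have \<psi>_int: "integral (cube a b) (\<psi>' j k) = 0" for j k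
    by (rule integral_partial_eq_0[OF \<psi>_der \<psi>'_cont \<psi>_zero less_imp_le[OF ab]])
  have S_nonneg: "S j k x \<ge> 0" for j k x
  proof (cases "j = k")
    case True
    then show ?thesis using sym_posdef_nonneg[OF pd, of x "u1 j j x"] by (simp add: S_def inner_commute)
  next
    case False
    from tri[OF this] show ?thesis by (auto simp: S_def)
  qed
  have L_eq: "- L x = Q x + (\<Sum>k\<in>UNIV. \<Sum>j\<in>UNIV. S j k x) - (\<Sum>k\<in>UNIV. \<Sum>j\<in>UNIV. \<psi>' j k x)" for x
  proof -
    have t: "(g x *v u k x) \<bullet> (u2 j k x + (A j x *v u1 j k x + th j k x *v u j x))
      = \<psi>' j k x - S j k x + (g x *v (th j k x *v u j x)) \<bullet> u k x" for j k
    proof -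
      have "(g x *v u k x) \<bullet> (th j k x *v u j x) = (g x *v (th j k x *v u j x)) \<bullet> u k x"
        by (simp add: sym_posdef_inner[OF pd, of x "u k x"] inner_commute)
      moreover have "(g x *v u k x) \<bullet> u2 j k x = u k x \<bullet> (g x *v u2 j k x)"
        by (rule sym_posdef_inner[OF pd])
      ultimately show ?thesis
        by (simp add: inner_add_right gA \<psi>'_def S_def)
    qed
    have "L x = (\<Sum>k\<in>UNIV. \<Sum>j\<in>UNIV. \<psi>' j k x - S j k x + (g x *v (th j k x *v u j x)) \<bullet> u k x)"
      unfolding L_def F1_eq inner_sum_right t ..
    then show ?thesis
      by (simp add: Q_def matvec_lin inner_sum_left sum.distrib sum_subtractf)
  qed

  have IBP: "integral (cube a b) (\<lambda>x. (g x *v u k x) \<bullet> F1 k x + D k x \<bullet> h x) = 0" for k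
  proof (rule integral_partial_eq_0[OF _ _ _ less_imp_le[OF ab]])
    show "has_partial k (\<lambda>x. (g x *v u k x) \<bullet> h x) (\<lambda>x. (g x *v u k x) \<bullet> F1 k x + D k x \<bullet> h x)"
      unfolding D_def
      by (intro has_partial_bilinear[OF ip] has_partial_bilinear[OF mv] has_C1D(2)[OF uC1] has_C1D(2)[OF gC1] has_C1D(2)[OF hC1])
    show "continuous_on UNIV (\<lambda>x. (g x *v u k x) \<bullet> F1 k x + D k x \<bullet> h x)"
      unfolding D_def by (intro continuous_on_add continuous_on_inner cont)
  qed (simp add: uz)

  have LC: "continuous_on UNIV L" unfolding L_def[abs_def]
    by (intro continuous_on_sum continuous_on_inner cont)
  have QC: "continuous_on UNIV Q" unfolding Q_def[abs_def]
    by (intro continuous_on_sum continuous_on_minus continuous_on_inner cont)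
  have SC: "continuous_on UNIV (S j k)" for j k unfolding S_def[abs_def]
    by (intro continuous_on_inner cont)
  have hhC: "continuous_on UNIV (\<lambda>x. (g x *v h x) \<bullet> h x)"
    by (intro continuous_on_inner cont)
  have kC: "continuous_on UNIV (\<lambda>x. (g x *v u k x) \<bullet> F1 k x + D k x \<bullet> h x)" for k
    unfolding D_def by (intro continuous_on_add continuous_on_inner cont)

  have "integral (cube a b) (\<lambda>x. L x + (g x *v h x) \<bullet> h x) = integral (cube a b) (\<lambda>x. \<Sum>k\<in>UNIV. (g x *v u k x) \<bullet> F1 k x + D k x \<bullet> h x)"
    by (rule arg_cong[of _ _ "integral (cube a b)"])
       (simp add: fun_eq_iff L_def D_def sum.distrib inner_sum_left[symmetric] flip: eqn)
  also have "\<dots> = (\<Sum>k\<in>UNIV. integral (cube a b) (\<lambda>x. (g x *v u k x) \<bullet> F1 k x + D k x \<bullet> h x))"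
    by (intro integral_sum integrable_on_cube kC) auto
  finally have A0: "integral (cube a b) (\<lambda>x. (g x *v h x) \<bullet> h x) = - integral (cube a b) L"
    by (simp add: IBP integral_add[OF integrable_on_cube[OF LC] integrable_on_cube[OF hhC]])

  have "integral (cube a b) (\<lambda>x. Q x - (\<Sum>k\<in>UNIV. \<Sum>j\<in>UNIV. \<psi>' j k x)) \<le> integral (cube a b) (\<lambda>x. - L x)"
    unfolding L_eq
    by (intro integral_le integrable_on_cube continuous_on_add continuous_on_diff continuous_on_sum QC SC \<psi>'_cont)
       (simp add: sum_nonneg S_nonneg)
  also have "integral (cube a b) (\<lambda>x. Q x - (\<Sum>k\<in>UNIV. \<Sum>j\<in>UNIV. \<psi>' j k x))
    = integral (cube a b) Q - (\<Sum>k\<in>UNIV. \<Sum>j\<in>UNIV. integral (cube a b) (\<psi>' j k))"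
    by (simp add: integral_diff integral_sum integrable_on_cube continuous_on_sum QC \<psi>'_cont)
  finally have QL: "integral (cube a b) Q \<le> - integral (cube a b) L"
    by (simp add: \<psi>_int)

  define w where "w k x = - u k x" for k x
  have wC: "continuous_on UNIV (w k)" for k
    unfolding w_def[abs_def] by (intro continuous_on_minus cont)
  have "integral (cube a b) (\<lambda>x. 2 * (\<Sum>k\<in>UNIV. (g x *v w k x) \<bullet> F1 k x)
       + (\<Sum>k\<in>UNIV. (g x *v (\<Sum>j\<in>UNIV. th j k x *v w j x)) \<bullet> w k x))
     = integral (cube a b) (\<lambda>x. - 2 * L x - Q x)"
    by (rule arg_cong[of _ _ "integral (cube a b)"])
       (simp add: fun_eq_iff L_def Q_def w_def matvec_lin sum_negf)
  also have "\<dots> = - 2 * integral (cube a b) L - integral (cube a b) Q"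
    using integral_diff[OF integrable_on_cube[OF continuous_on_mult_left[OF LC, of "-2"]] integrable_on_cube[OF QC], of a b]
    by simp
  also have "\<dots> \<ge> integral (cube a b) (\<lambda>x. (g x *v h x) \<bullet> h x)"
    using A0 QL by simp
  finally show ?thesis using wC unfolding h_def by blast
qed

section \<open>From cubes to the whole space\<close>

lemma wnorm_sq: "h \<in> sym_posdef \<Longrightarrow> (wnorm h u)\<^sup>2 = (h *v u) \<bullet> u"
  unfolding wnorm_def by (simp add: sym_posdef_nonneg)

lemma sym_posdef_coercive:
  fixes M :: "real^'d^'d"
  assumes "M \<in> sym_posdef"
  shows "\<exists>l>0. \<forall>d. l * (d \<bullet> d) \<le> (M *v d) \<bullet> d"
proof -
  let ?S = "sphere 0 1 :: (real^'d) set"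
  have "axis undefined 1 \<in> ?S" by (simp add: norm_axis_1)
  then have ne: "?S \<noteq> {}" by blast
  have "continuous_on ?S (\<lambda>d. (M *v d) \<bullet> d)"
    by (intro continuous_on_inner bounded_bilinear.continuous_on[OF bounded_bilinear_matrix_vector] continuous_on_const continuous_on_id)
  from continuous_attains_inf[OF compact_sphere ne this]
  obtain d0 where d0: "d0 \<in> ?S" "\<And>d. d \<in> ?S \<Longrightarrow> (M *v d0) \<bullet> d0 \<le> (M *v d) \<bullet> d" by blast
  define l where "l = (M *v d0) \<bullet> d0"
  have "l > 0" unfolding l_def using d0(1) by (intro sym_posdef_pos assms) auto
  moreover have "l * (d \<bullet> d) \<le> (M *v d) \<bullet> d" for d
  proof (cases "d = 0")
    case False
    have "d /\<^sub>R norm d \<in> ?S" using False by simp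
    from d0(2)[OF this] have "l \<le> ((M *v d) \<bullet> d) / (d \<bullet> d)"
      by (simp add: l_def matvec_lin dot_square_norm power2_eq_square divide_simps)
    then show ?thesis using False by (simp add: pos_le_divide_eq)
  qed simp
  ultimately show ?thesis by blast
qed

lemma integrable_componentwise_lborel:
  fixes f :: "real^'n \<Rightarrow> 'b::euclidean_space"
  assumes "\<And>b. b \<in> Basis \<Longrightarrow> integrable lborel (\<lambda>x. f x \<bullet> b)"
  shows "integrable lborel f"
proof -
  have "integrable lborel (\<lambda>x. \<Sum>b\<in>Basis. (f x \<bullet> b) *\<^sub>R b)"
    using assms by (intro Bochner_Integration.integrable_sum integrable_scaleR_left) auto
  then show ?thesis by (simp add: euclidean_representation)
qed

lemma integral_sym_posdef:
  fixes g :: "real^'n \<Rightarrow> real^'d^'d"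
  assumes pd: "\<And>x. g x \<in> sym_posdef" and i: "integrable lborel (\<lambda>x. indicator S x *\<^sub>R g x)"
    and S: "S \<in> sets lborel" "emeasure lborel S \<noteq> 0"
  shows "(\<integral>x. indicator S x *\<^sub>R g x \<partial>lborel) \<in> sym_posdef"
proof -
  let ?g = "\<lambda>x. indicator S x *\<^sub>R g x"
  have tr: "bounded_linear (transpose :: real^'d^'d \<Rightarrow> real^'d^'d)"
    by (rule bounded_linear_transpose)
  have "transpose (\<integral>x. ?g x \<partial>lborel) = (\<integral>x. transpose (?g x) \<partial>lborel)"
    by (rule integral_bounded_linear[OF tr i, symmetric])
  also have "(\<lambda>x. transpose (?g x)) = ?g"
    using pd by (auto simp: linear_simps[OF tr] sym_posdef_def)
  finally have "transpose (\<integral>x. ?g x \<partial>lborel) = (\<integral>x. ?g x \<partial>lborel)" .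
  moreover have "((\<integral>x. ?g x \<partial>lborel) *v u) \<bullet> u > 0" if u: "u \<noteq> 0" for u
  proof -
    have L: "bounded_linear (\<lambda>A::real^'d^'d. (A *v u) \<bullet> u)"
      by (intro bounded_linear_inner_left_comp bounded_bilinear.bounded_linear_left[OF bounded_bilinear_matrix_vector])
    have e: "((\<integral>x. ?g x \<partial>lborel) *v u) \<bullet> u = (\<integral>x. (?g x *v u) \<bullet> u \<partial>lborel)"
      by (rule integral_bounded_linear[OF L i, symmetric])
    have ii: "integrable lborel (\<lambda>x. (?g x *v u) \<bullet> u)"
      by (rule integrable_bounded_linear[OF L i])
    have nn: "(?g x *v u) \<bullet> u \<ge> 0" for x
      using sym_posdef_nonneg[OF pd, of x u] by (simp add: matvec_lin)
    have "(\<integral>x. (?g x *v u) \<bullet> u \<partial>lborel) \<noteq> 0"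
    proof
      assume "(\<integral>x. (?g x *v u) \<bullet> u \<partial>lborel) = 0"
      then have "AE x in lborel. (?g x *v u) \<bullet> u = 0"
        using integral_nonneg_eq_0_iff_AE[OF ii] nn by simp
      moreover have "x \<notin> S" if "(?g x *v u) \<bullet> u = 0" for x
        using that sym_posdef_pos[OF pd u, of x] by (auto simp: matvec_lin)
      ultimately have "AE x in lborel. x \<notin> S" by (rule eventually_mono)
      then have "emeasure lborel S = 0"
        using AE_iff_measurable[OF S(1), of "\<lambda>x. x \<notin> S"] by simp
      with S show False by simp
    qed
    moreover have "(\<integral>x. (?g x *v u) \<bullet> u \<partial>lborel) \<ge> 0" using nn by (intro integral_nonneg_AE) simp
    ultimately show ?thesis unfolding e by linarith
  qed
  ultimately show ?thesis by (simp add: sym_posdef_def)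
qed

lemma integral_cube_tendsto:
  fixes f :: "real^'n \<Rightarrow> 'b::euclidean_space"
  assumes f: "integrable lborel f"
  shows "(\<lambda>N. \<integral>x. indicator (cube (- real (Suc N)) (real (Suc N))) x *\<^sub>R f x \<partial>lborel) \<longlonglongrightarrow> (\<integral>x. f x \<partial>lborel)"
proof (rule integral_dominated_convergence[where w = "\<lambda>x. norm (f x)"])
  have fm: "f \<in> borel_measurable lborel" using f by simp
  then show "f \<in> borel_measurable lborel" .
  show "(\<lambda>x. indicator (cube (- real (Suc N)) (real (Suc N))) x *\<^sub>R f x) \<in> borel_measurable lborel" for N
    using fm by (intro borel_measurable_scaleR) (auto simp: cube_def)
  show "integrable lborel (\<lambda>x. norm (f x))" using f by simp
  show "AE x in lborel. (\<lambda>N. indicator (cube (- real (Suc N)) (real (Suc N))) x *\<^sub>R f x) \<longlonglongrightarrow> f x"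
  proof (rule AE_I2, rule tendsto_eventually)
    fix x :: "real^'n"
    obtain N0 where N0: "norm x \<le> real N0" using real_arch_simple by blast
    show "\<forall>\<^sub>F N in sequentially. indicator (cube (- real (Suc N)) (real (Suc N))) x *\<^sub>R f x = f x"
      unfolding eventually_sequentially
    proof (intro exI allI impI)
      fix N assume "N0 \<le> N"
      then have "norm x \<le> real (Suc N)" using N0 by linarith
      then have "\<bar>x $ i\<bar> \<le> real (Suc N)" for i using component_le_norm_cart[of x i] by linarith
      then have "x \<in> cube (- real (Suc N)) (real (Suc N))"
        unfolding mem_cube by (metis abs_le_iff minus_le_iff)
      then show "indicator (cube (- real (Suc N)) (real (Suc N))) x *\<^sub>R f x = f x" by simp
    qed
  qed
  show "AE x in lborel. norm (indicator (cube (- real (Suc N)) (real (Suc N))) x *\<^sub>R f x) \<le> norm (f x)" for N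
    by (simp add: indicator_def)
qed

text \<open>Write \<open>F - c = f + d\<close> with \<open>f = F - m\<close>, where \<open>m\<close> is the global mean and \<open>d\<close> is constant. The cross term is
\<open>2 \<langle>e\<^sub>N | d\<rangle>\<close> with \<open>e\<^sub>N\<close> the integral of \<open>g f\<close> over the cube, which tends to \<open>\<integral> g f = 0\<close>; the square of \<open>d\<close> is
weighted by a matrix that increases with the cube, hence bounded below by a fixed multiple \<open>l\<close> of
the identity. Whatever \<open>c\<close> is, at most \<open>|e\<^sub>N|\<^sup>2 / l\<close> is lost.\<close>

lemma variance_le_of_cubes:
  fixes g :: "real^'n \<Rightarrow> real^'d^'d" and F :: "real^'n \<Rightarrow> real^'d"
  assumes pd: "\<And>x. g x \<in> sym_posdef" and gC: "continuous_on UNIV g" and gi: "integrable lborel g"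
    and FC: "continuous_on UNIV F" and FL: "F \<in> weighted_L2 g"
    and Z: "Z = (\<integral>x. g x \<partial>lborel)"
    and bd: "\<And>N. \<exists>c. ennreal (integral (cube (- real (Suc N)) (real (Suc N))) (\<lambda>x. (g x *v (F x - c)) \<bullet> (F x - c))) \<le> A"
  shows "(\<integral>\<^sup>+x. ennreal ((wnorm (g x) (F x - matrix_inv Z *v (\<integral>z. g z *v F z \<partial>lborel)))\<^sup>2) \<partial>lborel) \<le> A"
proof -
  note mv = bounded_bilinear_matrix_vector
  let ?B = "\<lambda>N. cube (- real (Suc N)) (real (Suc N)) :: (real^'n) set"
  have Zpd: "Z \<in> sym_posdef"
    using integral_sym_posdef[OF pd, of UNIV] gi by (simp add: Z)
  define m where "m = matrix_inv Z *v (\<integral>z. g z *v F z \<partial>lborel)"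
  define f where "f x = F x - m" for x
  have fC: "continuous_on UNIV f" unfolding f_def[abs_def] by (intro continuous_intros FC)
  have contq: "continuous_on UNIV (\<lambda>x. (g x *v p x) \<bullet> q x)" if "continuous_on UNIV p" "continuous_on UNIV q" for p q
    by (intro continuous_on_inner bounded_bilinear.continuous_on[OF mv] gC that)
  have Lu: "bounded_linear (\<lambda>A::real^'d^'d. (A *v u) \<bullet> v)" for u v
    by (intro bounded_linear_inner_left_comp bounded_bilinear.bounded_linear_left[OF mv])
  have gui: "integrable lborel (\<lambda>x. (g x *v u) \<bullet> v)" for u v
    by (rule integrable_bounded_linear[OF Lu gi])
  have FFi: "integrable lborel (\<lambda>x. (g x *v F x) \<bullet> F x)"
  proof (rule integrableI_nonneg)
    show "(\<lambda>x. (g x *v F x) \<bullet> F x) \<in> borel_measurable lborel"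
      using borel_measurable_continuous_onI[OF contq[OF FC FC]] by simp
    show "(\<integral>\<^sup>+x. ennreal ((g x *v F x) \<bullet> F x) \<partial>lborel) < \<infinity>"
      using FL unfolding weighted_L2_def by (simp add: wnorm_sq pd)
  qed (simp add: sym_posdef_nonneg pd)
  have pol: "(h *v (u - v)) \<bullet> (u - v) = (h *v u) \<bullet> u - 2 * ((h *v u) \<bullet> v) + (h *v v) \<bullet> v"
      "(h *v (u + v)) \<bullet> (u + v) = (h *v u) \<bullet> u + 2 * ((h *v u) \<bullet> v) + (h *v v) \<bullet> v" if "h \<in> sym_posdef" for h :: "real^'d^'d" and u v
  proof -
    have "(h *v v) \<bullet> u = (h *v u) \<bullet> v" using sym_posdef_inner[OF that, of v u] by (simp add: inner_commute)
    then show "(h *v (u - v)) \<bullet> (u - v) = (h *v u) \<bullet> u - 2 * ((h *v u) \<bullet> v) + (h *v v) \<bullet> v"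
      "(h *v (u + v)) \<bullet> (u + v) = (h *v u) \<bullet> u + 2 * ((h *v u) \<bullet> v) + (h *v v) \<bullet> v"
      by (simp_all add: matvec_lin inner_diff_left inner_diff_right inner_add_left inner_add_right)
  qed
  have Fui: "integrable lborel (\<lambda>x. (g x *v F x) \<bullet> v)" for v
  proof (rule Bochner_Integration.integrable_bound[where f = "\<lambda>x. (g x *v F x) \<bullet> F x + (g x *v v) \<bullet> v"])
    show "integrable lborel (\<lambda>x. (g x *v F x) \<bullet> F x + (g x *v v) \<bullet> v)"
      by (intro Bochner_Integration.integrable_add FFi gui)
    show "(\<lambda>x. (g x *v F x) \<bullet> v) \<in> borel_measurable lborel"
      using borel_measurable_continuous_onI[OF contq[OF FC continuous_on_const]] by simp
    have "\<bar>(g x *v F x) \<bullet> v\<bar> \<le> (g x *v F x) \<bullet> F x + (g x *v v) \<bullet> v" for x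
      using sym_posdef_nonneg[OF pd, of x "F x - v"] sym_posdef_nonneg[OF pd, of x "F x + v"]
        sym_posdef_nonneg[OF pd, of x "F x"] sym_posdef_nonneg[OF pd, of x v]
      unfolding pol[OF pd] by linarith
    then show "AE x in lborel. norm ((g x *v F x) \<bullet> v) \<le> norm ((g x *v F x) \<bullet> F x + (g x *v v) \<bullet> v)"
      by (intro AE_I2) (auto intro: order_trans[OF _ abs_ge_self])
  qed
  have gFi: "integrable lborel (\<lambda>x. g x *v F x)"
    by (rule integrable_componentwise_lborel) (rule Fui)
  have gmi: "integrable lborel (\<lambda>x. g x *v v)" for v
    by (rule integrable_bounded_linear[OF bounded_bilinear.bounded_linear_left[OF mv] gi])
  have gfi: "integrable lborel (\<lambda>x. g x *v f x)"
    unfolding f_def matvec_lin by (intro Bochner_Integration.integrable_diff gFi gmi)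
  have gf0: "(\<integral>x. g x *v f x \<partial>lborel) = 0"
  proof -
    have "(\<integral>x. g x *v f x \<partial>lborel) = (\<integral>x. g x *v F x \<partial>lborel) - (\<integral>x. g x *v m \<partial>lborel)"
      unfolding f_def matvec_lin by (rule Bochner_Integration.integral_diff[OF gFi gmi])
    also have "(\<integral>x. g x *v m \<partial>lborel) = Z *v m"
      unfolding Z by (rule integral_bounded_linear[OF bounded_bilinear.bounded_linear_left[OF mv] gi])
    also have "\<dots> = (\<integral>x. g x *v F x \<partial>lborel)"
      unfolding m_def by (rule matrix_inv_vector_mult(1)[OF sym_posdef_invertible[OF Zpd]])
    finally show ?thesis by simp
  qed
  have ffi: "integrable lborel (\<lambda>x. (g x *v f x) \<bullet> f x)"
    unfolding f_def pol[OF pd]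
    by (intro Bochner_Integration.integrable_add Bochner_Integration.integrable_diff integrable_mult_right FFi Fui gui)
  have ff_nn: "(g x *v f x) \<bullet> f x \<ge> 0" for x by (rule sym_posdef_nonneg[OF pd])

  define e where "e N = (\<integral>x. indicator (?B N) x *\<^sub>R (g x *v f x) \<partial>lborel)" for N
  define q where "q N = (\<integral>x. indicator (?B N) x *\<^sub>R ((g x *v f x) \<bullet> f x) \<partial>lborel)" for N
  have e0: "e \<longlonglongrightarrow> 0"
    using integral_cube_tendsto[OF gfi] unfolding e_def[abs_def] gf0 .
  have q0: "q \<longlonglongrightarrow> (\<integral>x. (g x *v f x) \<bullet> f x \<partial>lborel)"
    using integral_cube_tendsto[OF ffi] unfolding q_def[abs_def] .
  have cubem: "?B N \<in> sets lborel" for N by (simp add: cube_def)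
  have indi: "integrable lborel (\<lambda>x. indicator (?B N) x *\<^sub>R p x)" if "integrable lborel p" for N and p :: "real^'n \<Rightarrow> 'c::euclidean_space"
    by (rule integrable_mult_indicator[OF cubem that])
  define M where "M N = (\<integral>x. indicator (?B N) x *\<^sub>R g x \<partial>lborel)" for N
  have "M 0 \<in> sym_posdef"
    unfolding M_def
  proof (rule integral_sym_posdef[OF pd indi[OF gi] cubem])
    have "emeasure lborel (?B 0) = ennreal (\<Prod>b\<in>Basis. ((\<chi> i. 1) - (\<chi> i. - 1) :: real^'n) \<bullet> b)"
      unfolding cube_def by (subst emeasure_lborel_cbox) (auto simp: Basis_vec_def inner_axis)
    moreover have "(\<Prod>b\<in>Basis. ((\<chi> i. 1) - (\<chi> i. - 1) :: real^'n) \<bullet> b) > 0"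
    proof (rule prod_pos)
      fix b :: "real^'n" assume "b \<in> Basis"
      then show "((\<chi> i. 1) - (\<chi> i. - 1) :: real^'n) \<bullet> b > 0"
        by (auto simp: Basis_vec_def inner_axis)
    qed
    then have "ennreal (\<Prod>b\<in>Basis. ((\<chi> i. 1) - (\<chi> i. - 1) :: real^'n) \<bullet> b) \<noteq> 0"
      by (simp only: ennreal_eq_0_iff not_le)
    ultimately show "emeasure lborel (?B 0) \<noteq> 0" by simp
  qed
  then obtain l where l: "l > 0" "\<And>d. l * (d \<bullet> d) \<le> (M 0 *v d) \<bullet> d"
    using sym_posdef_coercive by blast
  have Md: "(M N *v d) \<bullet> d = (\<integral>x. indicator (?B N) x *\<^sub>R ((g x *v d) \<bullet> d) \<partial>lborel)" for N d
    unfolding M_def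
    using integral_bounded_linear[OF Lu[of d d] indi[OF gi, of N]] by (simp add: matvec_lin)
  have Mmono: "(M 0 *v d) \<bullet> d \<le> (M N *v d) \<bullet> d" for N d
    unfolding Md
  proof (rule integral_mono[OF indi[OF gui] indi[OF gui]])
    fix x :: "real^'n"
    have "x \<in> ?B N" if "x \<in> ?B 0"
      unfolding mem_cube
    proof
      fix i
      have "- 1 \<le> x $ i \<and> x $ i \<le> 1" using that by (simp add: mem_cube)
      then show "- real (Suc N) \<le> x $ i \<and> x $ i \<le> real (Suc N)" by simp
    qed
    then show "indicator (?B 0) x *\<^sub>R ((g x *v d) \<bullet> d) \<le> indicator (?B N) x *\<^sub>R ((g x *v d) \<bullet> d)"
      using sym_posdef_nonneg[OF pd, of x d] by (auto simp: indicator_def)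
  qed
  \<comment> \<open>Minimise over \<open>d = m - c\<close>.\<close>
  have low: "q N - (norm (e N))\<^sup>2 / l \<le> integral (?B N) (\<lambda>x. (g x *v (F x - c)) \<bullet> (F x - c))" for N c
  proof -
    define d where "d = m - c"
    have Fc: "F x - c = f x + d" for x by (simp add: f_def d_def)
    have fdi: "integrable lborel (\<lambda>x. (g x *v f x) \<bullet> d)"
      by (rule integrable_bounded_linear[OF bounded_linear_inner_left gfi])
    note i1 = indi[OF ffi, of N] and i2 = integrable_mult_right[where c = 2, OF indi[OF fdi, of N]] and i3 = indi[OF gui[of d d], of N]
    have cc: "continuous_on UNIV (\<lambda>x. (g x *v (F x - c)) \<bullet> (F x - c))"
      by (intro contq continuous_intros FC)
    have "integral (?B N) (\<lambda>x. (g x *v (F x - c)) \<bullet> (F x - c))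
       = (\<integral>x. indicator (?B N) x *\<^sub>R ((g x *v f x) \<bullet> f x + 2 * ((g x *v f x) \<bullet> d) + (g x *v d) \<bullet> d) \<partial>lborel)"
      unfolding integral_cube_eq_lborel[OF cc] unfolding Fc pol[OF pd] ..
    also have "\<dots> = (\<integral>x. indicator (?B N) x *\<^sub>R ((g x *v f x) \<bullet> f x) + 2 * (indicator (?B N) x *\<^sub>R ((g x *v f x) \<bullet> d)) + indicator (?B N) x *\<^sub>R ((g x *v d) \<bullet> d) \<partial>lborel)"
      by (simp add: algebra_simps)
    also have "\<dots> = (\<integral>x. indicator (?B N) x *\<^sub>R ((g x *v f x) \<bullet> f x) \<partial>lborel) + 2 * (\<integral>x. indicator (?B N) x *\<^sub>R ((g x *v f x) \<bullet> d) \<partial>lborel) + (\<integral>x. indicator (?B N) x *\<^sub>R ((g x *v d) \<bullet> d) \<partial>lborel)"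
      by (simp only: Bochner_Integration.integral_add[OF Bochner_Integration.integrable_add[OF i1 i2] i3]
          Bochner_Integration.integral_add[OF i1 i2] integral_mult_right_zero)
    also have "(\<integral>x. indicator (?B N) x *\<^sub>R ((g x *v f x) \<bullet> d) \<partial>lborel) = e N \<bullet> d"
      unfolding e_def using integral_bounded_linear[OF bounded_linear_inner_left[of d] indi[OF gfi, of N]] by simp
    also have "(\<integral>x. indicator (?B N) x *\<^sub>R ((g x *v d) \<bullet> d) \<partial>lborel) = (M N *v d) \<bullet> d"
      by (rule Md[symmetric])
    finally have "integral (?B N) (\<lambda>x. (g x *v (F x - c)) \<bullet> (F x - c)) = q N + 2 * (e N \<bullet> d) + (M N *v d) \<bullet> d"
      by (simp add: q_def)
    moreover have "l * (d \<bullet> d) \<le> (M N *v d) \<bullet> d" using l(2) Mmono order_trans by blast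
    moreover have "- (norm (e N))\<^sup>2 / l \<le> 2 * (e N \<bullet> d) + l * (d \<bullet> d)"
    proof -
      have "0 \<le> (e N + l *\<^sub>R d) \<bullet> (e N + l *\<^sub>R d)" by simp
      also have "\<dots> = (norm (e N))\<^sup>2 + l * (2 * (e N \<bullet> d) + l * (d \<bullet> d))"
        by (simp add: inner_add_left inner_add_right inner_commute power2_norm_eq_inner algebra_simps)
      finally show ?thesis using l(1) by (simp add: field_simps)
    qed
    ultimately show ?thesis by simp
  qed
  have "(\<lambda>N. q N - (norm (e N))\<^sup>2 / l) \<longlonglongrightarrow> (\<integral>x. (g x *v f x) \<bullet> f x \<partial>lborel) - (norm (0::real^'d))\<^sup>2 / l"
    using l(1) by (intro tendsto_intros q0 e0) simp
  then have "(\<lambda>N. ennreal (q N - (norm (e N))\<^sup>2 / l)) \<longlonglongrightarrow> ennreal (\<integral>x. (g x *v f x) \<bullet> f x \<partial>lborel)"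
    by (intro tendsto_ennrealI) simp
  moreover have "ennreal (q N - (norm (e N))\<^sup>2 / l) \<le> A" for N
    using bd[of N] low[of N] by (meson ennreal_leI order_trans)
  ultimately have "ennreal (\<integral>x. (g x *v f x) \<bullet> f x \<partial>lborel) \<le> A"
    by (intro LIMSEQ_le_const2) auto
  moreover have "(\<integral>\<^sup>+x. ennreal ((wnorm (g x) (f x))\<^sup>2) \<partial>lborel) = ennreal (\<integral>x. (g x *v f x) \<bullet> f x \<partial>lborel)"
    unfolding wnorm_sq[OF pd] by (rule nn_integral_eq_integral[OF ffi]) (simp add: ff_nn)
  ultimately show ?thesis unfolding f_def m_def by simp
qed

section \<open>Regularity of the weight and of the function\<close>

lemma has_derivative_imp_has_partial:
  fixes f :: "real^'n \<Rightarrow> 'b::real_normed_vector"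
  assumes "\<And>x. (f has_derivative f' x) (at x)"
  shows "has_partial k f (\<lambda>x. f' x (axis k 1))"
  unfolding has_partial_def
proof
  fix x :: "real^'n"
  have "((\<lambda>t. x + t *\<^sub>R axis k 1) has_derivative (\<lambda>t. t *\<^sub>R axis k 1)) (at 0)"
    by (auto intro!: derivative_eq_intros)
  moreover have "(f has_derivative f' x) (at (x + 0 *\<^sub>R axis k 1))" using assms by simp
  ultimately have "(f \<circ> (\<lambda>t. x + t *\<^sub>R axis k 1) has_derivative f' x \<circ> (\<lambda>t. t *\<^sub>R axis k 1)) (at 0)"
    by (rule diff_chain_at)
  moreover have "linear (f' x)" using assms has_derivative_linear by blast
  ultimately show "((\<lambda>t. f (x + t *\<^sub>R axis k 1)) has_vector_derivative f' x (axis k 1)) (at 0)"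
    by (simp add: has_vector_derivative_def o_def linear_cmul)
qed

lemma C1_fun_has_C1:
  assumes f': "\<And>x. (f has_derivative blinfun_apply (f' x)) (at x)" and c: "continuous_on UNIV f'"
  shows "has_C1 f (\<lambda>k x. blinfun_apply (f' x) (axis k 1))"
proof -
  have "continuous_on UNIV f"
    using f' by (intro differentiable_imp_continuous_on) (auto simp: differentiable_on_def differentiable_def)
  then show ?thesis
    unfolding has_C1_def using has_derivative_imp_has_partial[OF f']
    by (auto intro!: continuous_intros c)
qed

lemma C1_fun_obtain:
  assumes "C1_fun f" obtains f1 where "has_C1 f f1"
  using assms C1_fun_has_C1 unfolding C1_fun_def by blast

lemma C2_fun_obtain:
  fixes f :: "real^'n \<Rightarrow> 'b::euclidean_space"
  assumes "C2_fun f"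
  obtains f1 f2 where "\<And>j. has_C1_along j f f1 (f2 j)"
proof -
  obtain f' :: "real^'n \<Rightarrow> (real^'n) \<Rightarrow>\<^sub>L 'b" where f': "\<And>x. (f has_derivative blinfun_apply (f' x)) (at x)" and c1: "C1_fun f'"
    using assms unfolding C2_fun_def by blast
  obtain h where h: "has_C1 f' h" using C1_fun_obtain[OF c1] .
  have f: "has_C1 f (\<lambda>k x. blinfun_apply (f' x) (axis k 1))"
    by (rule C1_fun_has_C1[OF f' has_C1D(1)[OF h]])
  have "has_C1_along j f (\<lambda>k x. blinfun_apply (f' x) (axis k 1)) (\<lambda>k x. blinfun_apply (h k x) (axis j 1))" for j
    by (rule has_C1_along_intro[OF f has_C1_linear[OF bounded_bilinear.bounded_linear_left[OF bounded_bilinear_blinfun_apply] h]])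
  then show ?thesis by (rule that)
qed

section \<open>Pointwise bounds for the dual integrand\<close>

text \<open>Scaling \<open>U\<close> to \<open>Q U = 1\<close> and the inequality between the arithmetic and geometric means. If \<open>Q U = 0\<close>,
then all multiples of \<open>U\<close> are admissible in the supremum, so a finite polar form forces \<open>ip U v = 0\<close>.\<close>

lemma le_polar:
  fixes v :: "'e::real_vector"
  assumes ip: "\<And>t u. ip (t *\<^sub>R u) v = t * ip u v" and Q: "\<And>t u. Q (t *\<^sub>R u) = t\<^sup>2 * Q u" and Q0: "\<And>u. Q u \<ge> 0"
  shows "ennreal (2 * ip U v - Q U) \<le> polar ip Q v"
proof (cases "polar ip Q v = \<infinity>")
  case False
  then obtain r where r: "r \<ge> 0" "polar ip Q v = ennreal r"
    by (metis ennreal_cases infinity_ennreal_def)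
  have bd: "(ip u v)\<^sup>2 \<le> r" if "Q u \<le> 1" for u
  proof -
    have "ennreal ((ip u v)\<^sup>2) \<le> polar ip Q v"
      unfolding polar_def using that by (intro SUP_upper) simp
    then show ?thesis using r by (simp add: ennreal_le_iff)
  qed
  have "2 * ip U v - Q U \<le> r"
  proof (cases "Q U = 0")
    case True
    have "ip U v = 0"
    proof (rule ccontr)
      assume ne: "ip U v \<noteq> 0"
      have "(ip (((r + 1) / ip U v) *\<^sub>R U) v)\<^sup>2 \<le> r" by (rule bd) (simp add: Q True)
      then have "(r + 1)\<^sup>2 \<le> r" using ne by (simp add: ip)
      moreover have "(r + 1)\<^sup>2 = r * r + 2 * r + 1" by (simp add: power2_eq_square algebra_simps)
      moreover note mult_nonneg_nonneg[OF r(1) r(1)]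
      ultimately show False using r(1) by linarith
    qed
    then show ?thesis using True r by simp
  next
    case False
    then have q: "Q U > 0" using Q0[of U] by simp
    have "(ip ((1 / sqrt (Q U)) *\<^sub>R U) v)\<^sup>2 \<le> r"
      by (rule bd) (use q in \<open>simp add: Q power_divide\<close>)
    then have "(ip U v)\<^sup>2 / Q U \<le> r" using q by (simp add: ip power_divide)
    then have "(ip U v)\<^sup>2 \<le> r * Q U" using q by (simp add: pos_divide_le_eq)
    moreover have "0 \<le> (ip U v - Q U)\<^sup>2" by simp
    ultimately have "Q U * (2 * ip U v - Q U) \<le> Q U * r"
      by (simp add: power2_eq_square algebra_simps)
    then show ?thesis using q by simp
  qed
  then show ?thesis using r by (simp add: ennreal_leI)
qed simp

lemma column_scaleR: "column k (t *\<^sub>R U) = t *\<^sub>R column k (U :: real^'n^'d)"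
  by (simp add: column_def vec_eq_iff)

lemma column_diff: "column k (U - V) = column k U - column k (V :: real^'n^'d)"
  by (simp add: column_def vec_eq_iff)

lemma column_minus: "column k (- U) = - column k (U :: real^'n^'d)"
  by (simp add: column_def vec_eq_iff)

lemma wmat_inner_lin:
  "wmat_inner h (t *\<^sub>R U) V = t * wmat_inner h U V"
  "wmat_inner h U (t *\<^sub>R V) = t * wmat_inner h U V"
  "wmat_inner h (U - U') V = wmat_inner h U V - wmat_inner h U' V"
  "wmat_inner h U (V - V') = wmat_inner h U V - wmat_inner h U V'"
  "wmat_inner h (- U) V = - wmat_inner h U V"
  by (simp_all add: wmat_inner_def column_scaleR column_diff column_minus matvec_lin inner_diff_left inner_diff_right
     sum_subtractf sum_distrib_left sum_negf)

lemma wmat_inner_commute: "h \<in> sym_posdef \<Longrightarrow> wmat_inner h U V = wmat_inner h V U"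
  unfolding wmat_inner_def by (intro sum.cong refl) (metis sym_posdef_inner inner_commute)

text \<open>Expanding the nonnegative value of \<open>U \<mapsto> - \<langle>T U | U\<rangle>\<close> at \<open>U - w\<close> with \<open>- T w = v\<close>.\<close>

lemma le_inverse_form:
  assumes h: "h \<in> sym_posdef" and lin: "linear T" and bij: "bij T"
    and neg: "\<And>U. wmat_inner h (T U) U \<le> 0" and sym: "\<And>U V. wmat_inner h (T U) V = wmat_inner h (T V) U"
  shows "2 * wmat_inner h U v + wmat_inner h (T U) U \<le> wmat_inner h (inv (\<lambda>U. - T U) v) v"
proof -
  define w where "w = inv (\<lambda>U. - T U) v"
  have "surj (\<lambda>U. - T U)"
  proof (rule surjI)
    show "- T (inv T (- y)) = y" for y using bij by (simp add: bij_is_surj surj_f_inv_f)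
  qed
  then have w: "v = - T w" unfolding w_def by (simp add: surj_f_inv_f[of "\<lambda>U. - T U" v])
  have "wmat_inner h (T (U - w)) (U - w) \<le> 0" by (rule neg)
  then have "wmat_inner h (T U) U - 2 * wmat_inner h (T w) U + wmat_inner h (T w) w \<le> 0"
    using sym[of U w] by (simp add: linear_diff[OF lin] wmat_inner_lin)
  moreover have "wmat_inner h U v = - wmat_inner h (T w) U"
    using wmat_inner_commute[OF h, of U v] by (simp add: w wmat_inner_lin)
  moreover have "wmat_inner h w v = - wmat_inner h (T w) w"
    using wmat_inner_commute[OF h, of w v] by (simp add: w wmat_inner_lin)
  ultimately show ?thesis unfolding w_def[symmetric] by linarith
qed

text \<open>\<open>g \<theta>\<^sub>j\<^sub>k = \<partial>\<^sub>k \<partial>\<^sub>j g - (\<partial>\<^sub>k g) g\<^sup>-\<^sup>1 (\<partial>\<^sub>j g)\<close>, whose transpose is \<open>g \<theta>\<^sub>k\<^sub>j\<close>: the derivatives of \<open>g\<close> are symmetric matrices and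
second derivatives commute.\<close>

lemma Theta_symmetric:
  fixes g :: "real^'n \<Rightarrow> real^'d^'d"
  assumes g: "\<And>j. has_C1_along j g g1 (g2 j)" and pd: "\<And>x. g x \<in> sym_posdef"
  shows "wmat_inner (g x) (Theta g x U) V = wmat_inner (g x) (Theta g x V) U"
proof -
  have gC1: "has_C1 g g1" using has_C1_alongD(1)[OF g] .
  have ginv: "invertible (g x)" for x using sym_posdef_invertible[OF pd] .
  have tr: "bounded_linear (transpose :: real^'d^'d \<Rightarrow> real^'d^'d)"
    by (rule bounded_linear_transpose)
  have trg: "(\<lambda>x. transpose (g x)) = g" using pd by (auto simp: sym_posdef_def)
  have g1T: "(\<lambda>x. transpose (g1 k x)) = g1 k" for k
    using has_partial_linear[OF tr has_C1D(2)[OF gC1, of k]] has_C1D(2)[OF gC1, of k]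
    unfolding trg by (rule has_partial_unique)
  have g2T: "(\<lambda>x. transpose (g2 j k x)) = g2 j k" for j k
    using has_partial_linear[OF tr has_C1D(2)[OF has_C1_alongD(2)[OF g[of j]], of k]] has_C1D(2)[OF has_C1_alongD(2)[OF g[of j]], of k]
    unfolding g1T by (rule has_partial_unique)
  have g2s: "g2 j k = g2 k j" for j k
    using has_C1_alongD(3)[OF g[of j], of k] has_C1D(2)[OF has_C1_alongD(2)[OF g[of k]], of j]
    by (rule has_partial_unique)
  have symT: "(M *v u) \<bullet> v = u \<bullet> (M *v v)" if "transpose M = M" for M :: "real^'d^'d" and u v
    using that by (metis dot_lmul_matrix transpose_matrix_vector)
  let ?m = "\<lambda>x. matrix_inv (g x)"
  have mT: "(?m x *v u) \<bullet> v = u \<bullet> (?m x *v v)" for u v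
    using sym_posdef_inner[OF pd, of x "?m x *v u" "?m x *v v"]
    by (simp add: matrix_inv_vector_mult ginv)
  have th: "theta g j k x = ?m x ** g2 j k x + (- (?m x ** (g1 k x ** ?m x))) ** g1 j x" for j k
  proof -
    have pj: "partial_deriv j g = g1 j" by (rule partial_deriv_eq[OF has_C1D(2)[OF gC1]])
    have "has_partial k (\<lambda>x. ?m x ** g1 j x) (\<lambda>x. ?m x ** g2 j k x + (- (?m x ** (g1 k x ** ?m x))) ** g1 j x)"
      by (rule has_C1D(2)[OF has_C1_bilinear[OF bounded_bilinear_matrix_mult has_C1_matrix_inv[OF gC1 ginv] has_C1_alongD(2)[OF g[of j]]]])
    from partial_deriv_eq[OF this] show ?thesis unfolding theta_def pj by simp
  qed
  have gth: "g x *v (theta g j k x *v u) = g2 j k x *v u - g1 k x *v (?m x *v (g1 j x *v u))" for j k u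
    unfolding th by (simp add: matvec_lin matrix_inv_vector_mult ginv flip: matrix_vector_mul_assoc)
  have sym1: "(g x *v (theta g j k x *v u)) \<bullet> v = (g x *v (theta g k j x *v v)) \<bullet> u" for j k u v
  proof -
    have "(g2 j k x *v u) \<bullet> v = (g2 k j x *v v) \<bullet> u"
      using symT[OF fun_cong[OF g2T[of j k]], of x u v] by (simp add: g2s[of j k] inner_commute)
    moreover have "(g1 k x *v (?m x *v (g1 j x *v u))) \<bullet> v = (g1 j x *v (?m x *v (g1 k x *v v))) \<bullet> u"
      unfolding symT[OF fun_cong[OF g1T[of k]], of x _ v] mT symT[OF fun_cong[OF g1T[of j]], of x u]
      by (rule inner_commute)
    ultimately show ?thesis unfolding gth inner_diff_left by simp
  qed
  have "wmat_inner (g x) (Theta g x U) V = (\<Sum>k\<in>UNIV. \<Sum>j\<in>UNIV. (g x *v (theta g j k x *v column j U)) \<bullet> column k V)"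
    by (simp add: wmat_inner_def column_Theta matvec_lin inner_sum_left)
  also have "\<dots> = (\<Sum>k\<in>UNIV. \<Sum>j\<in>UNIV. (g x *v (theta g k j x *v column k V)) \<bullet> column j U)"
    by (intro sum.cong refl sym1)
  also have "\<dots> = wmat_inner (g x) (Theta g x V) U"
    by (subst sum.swap) (simp add: wmat_inner_def column_Theta matvec_lin inner_sum_left)
  finally show ?thesis .
qed

section \<open>The Brascamp--Lieb inequality\<close>

text \<open>Both inequalities of the theorem are instances, with \<open>K\<close> the polar form or the inverse quadratic
form. On each cube \<open>K\<close> is compared with the continuous integrand of \<open>cube_certificate\<close>.\<close>

lemma variance_le_dual:
  fixes g :: "real^'n \<Rightarrow> real^'d^'d" and F :: "real^'n \<Rightarrow> real^'d"
  assumes g: "\<And>j. has_C1_along j g g1 (g2 j)" and pd: "\<And>x. g x \<in> sym_posdef" and gi: "integrable lborel g"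
    and F: "has_C1 F F1" and FL: "F \<in> weighted_L2 g" and Z: "Z = (\<integral>x. g x \<partial>lborel)"
    and K: "AE x in lborel. \<forall>U. ennreal (2 * wmat_inner (g x) U (grad_mat F x) + wmat_inner (g x) (Theta g x U) U) \<le> K x"
  shows "(\<integral>\<^sup>+x. ennreal ((wnorm (g x) (F x - matrix_inv Z *v (\<integral>z. g z *v F z \<partial>lborel)))\<^sup>2) \<partial>lborel) \<le> (\<integral>\<^sup>+x. K x \<partial>lborel)"
proof (rule variance_le_of_cubes[OF pd _ gi _ FL Z])
  note mv = bounded_bilinear_matrix_vector
  have gC1: "has_C1 g g1" using has_C1_alongD(1)[OF g] .
  show gC: "continuous_on UNIV g" by (rule has_C1D(1)[OF gC1])
  show "continuous_on UNIV F" by (rule has_C1D(1)[OF F])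
  have ginv: "invertible (g x)" for x using sym_posdef_invertible[OF pd] .
  define th where "th j k x = matrix_inv (g x) ** g2 j k x + (- (matrix_inv (g x) ** (g1 k x ** matrix_inv (g x)))) ** g1 j x" for j k x
  have thC1: "has_C1 (\<lambda>x. matrix_inv (g x) ** g1 j x) (th j)" for j
    using has_C1_bilinear[OF bounded_bilinear_matrix_mult has_C1_matrix_inv[OF gC1 ginv] has_C1_alongD(2)[OF g[of j]]]
    unfolding th_def[abs_def] .
  have th: "theta g j k x = th j k x" for j k x
    unfolding theta_def partial_deriv_eq[OF has_C1D(2)[OF gC1]] partial_deriv_eq[OF has_C1D(2)[OF thC1]] ..
  have grad: "column k (grad_mat F x) = F1 k x" for k x
    by (simp add: column_def grad_mat_def vec_eq_iff partial_deriv_eq[OF has_C1D(2)[OF F]])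
  fix N
  let ?B = "cube (- real (Suc N)) (real (Suc N)) :: (real^'n) set"
  obtain c w where wC: "\<And>k. continuous_on UNIV (w k)" and le:
    "integral ?B (\<lambda>x. (g x *v (F x - c)) \<bullet> (F x - c)) \<le>
    integral ?B (\<lambda>x. 2 * (\<Sum>k\<in>UNIV. (g x *v w k x) \<bullet> F1 k x)
       + (\<Sum>k\<in>UNIV. (g x *v (\<Sum>j\<in>UNIV. th j k x *v w j x)) \<bullet> w k x))"
    using cube_certificate[OF g pd _ F thC1, of "- real (Suc N)" "real (Suc N)"] by auto
  define \<psi> where "\<psi> x = 2 * (\<Sum>k\<in>UNIV. (g x *v w k x) \<bullet> F1 k x)
       + (\<Sum>k\<in>UNIV. (g x *v (\<Sum>j\<in>UNIV. th j k x *v w j x)) \<bullet> w k x)" for x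
  have \<psi>C: "continuous_on UNIV \<psi>" unfolding \<psi>_def[abs_def]
    by (intro continuous_on_add continuous_on_mult continuous_on_const continuous_on_sum continuous_on_inner
        bounded_bilinear.continuous_on[OF mv] wC gC has_C1D(3)[OF F] has_C1D(3)[OF thC1])
  have \<psi>K: "AE x in lborel. ennreal (\<psi> x) \<le> K x"
    using K
  proof eventually_elim
    fix x assume a: "\<forall>U. ennreal (2 * wmat_inner (g x) U (grad_mat F x) + wmat_inner (g x) (Theta g x U) U) \<le> K x"
    define U :: "real^'n^'d" where "U = (\<chi> i k. w k x $ i)"
    have col: "column k U = w k x" for k by (simp add: U_def column_def vec_eq_iff)
    have "\<psi> x = 2 * wmat_inner (g x) U (grad_mat F x) + wmat_inner (g x) (Theta g x U) U"
      by (simp add: \<psi>_def wmat_inner_def column_Theta col grad th)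
    with a show "ennreal (\<psi> x) \<le> K x" by simp
  qed
  have "ennreal (integral ?B (\<lambda>x. (g x *v (F x - c)) \<bullet> (F x - c))) \<le> ennreal (integral ?B \<psi>)"
    using le unfolding \<psi>_def[abs_def] by (rule ennreal_leI)
  also have "integral ?B \<psi> = (\<integral>x. indicator ?B x *\<^sub>R \<psi> x \<partial>lborel)"
    by (rule integral_cube_eq_lborel[OF \<psi>C])
  also have "ennreal \<dots> \<le> ennreal (\<integral>x. max 0 (indicator ?B x *\<^sub>R \<psi> x) \<partial>lborel)"
    by (intro ennreal_leI integral_mono integrable_max integrable_cube[OF \<psi>C]) simp_all
  also have "\<dots> = (\<integral>\<^sup>+x. ennreal (max 0 (indicator ?B x *\<^sub>R \<psi> x)) \<partial>lborel)"
    by (intro nn_integral_eq_integral[symmetric] integrable_max integrable_cube[OF \<psi>C] AE_I2) simp_all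
  also have "\<dots> \<le> (\<integral>\<^sup>+x. K x \<partial>lborel)"
  proof (rule nn_integral_mono_AE)
    show "AE x in lborel. ennreal (max 0 (indicator ?B x *\<^sub>R \<psi> x)) \<le> K x"
      using \<psi>K by eventually_elim (auto simp: indicator_def max_def)
  qed
  finally show "\<exists>c. ennreal (integral ?B (\<lambda>x. (g x *v (F x - c)) \<bullet> (F x - c))) \<le> (\<integral>\<^sup>+x. K x \<partial>lborel)" by blast
qed

theorem theorem4:
  fixes g :: "real^'n \<Rightarrow> real^'d^'d" and Z :: "real^'d^'d"
  assumes "N_log_concave g"
    and "integrable lborel g"
    and "Z = (\<integral>x. g x \<partial>lborel)"
  shows "Z \<in> sym_posdef \<and>
    (\<forall>F. C1_fun F \<and> F \<in> weighted_L2 g \<longrightarrow>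
      (\<integral>\<^sup>+x. ennreal ((wnorm (g x) (F x - matrix_inv Z *v (\<integral>z. g z *v F z \<partial>lborel)))\<^sup>2) \<partial>lborel)
        \<le> (\<integral>\<^sup>+x. polar (wmat_inner (g x)) (\<lambda>U. - wmat_inner (g x) (Theta g x U) U)
                (grad_mat F x) \<partial>lborel) \<and>
      ((AE x in lborel. bij (Theta g x)) \<longrightarrow>
        (\<integral>\<^sup>+x. ennreal ((wnorm (g x) (F x - matrix_inv Z *v (\<integral>z. g z *v F z \<partial>lborel)))\<^sup>2) \<partial>lborel)
          \<le> (\<integral>\<^sup>+x. ennreal (wmat_inner (g x) (inv (\<lambda>U. - Theta g x U) (grad_mat F x)) (grad_mat F x))
                \<partial>lborel)))"
proof -
  have pd: "g x \<in> sym_posdef" for x using assms(1) unfolding N_log_concave_def by blast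
  have C2: "C2_fun g" and neg: "wmat_inner (g x) (Theta g x U) U \<le> 0" for x U
    using assms(1) unfolding N_log_concave_def by blast+
  obtain g1 g2 where g: "\<And>j. has_C1_along j g g1 (g2 j)" using C2_fun_obtain[OF C2] by metis
  have "Z \<in> sym_posdef"
    using integral_sym_posdef[OF pd, of UNIV] assms(2,3) by simp
  moreover have "(\<integral>\<^sup>+x. ennreal ((wnorm (g x) (F x - matrix_inv Z *v (\<integral>z. g z *v F z \<partial>lborel)))\<^sup>2) \<partial>lborel)
        \<le> (\<integral>\<^sup>+x. polar (wmat_inner (g x)) (\<lambda>U. - wmat_inner (g x) (Theta g x U) U) (grad_mat F x) \<partial>lborel)"
    if C: "C1_fun F" and L: "F \<in> weighted_L2 g" for F
  proof -
    obtain F1 where F: "has_C1 F F1" using C1_fun_obtain[OF C] .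
    show ?thesis
    proof (rule variance_le_dual[OF g pd assms(2) F L assms(3)], rule AE_I2, rule allI)
      fix x and U :: "real^'n^'d"
      let ?Q = "\<lambda>U. - wmat_inner (g x) (Theta g x U) U"
      have "ennreal (2 * wmat_inner (g x) U (grad_mat F x) - ?Q U) \<le> polar (wmat_inner (g x)) ?Q (grad_mat F x)"
      proof (rule le_polar)
        fix t and u :: "real^'n^'d"
        show "wmat_inner (g x) (t *\<^sub>R u) (grad_mat F x) = t * wmat_inner (g x) u (grad_mat F x)"
          by (rule wmat_inner_lin)
        show "?Q (t *\<^sub>R u) = t\<^sup>2 * ?Q u"
          by (simp add: linear_cmul[OF linear_Theta] wmat_inner_lin power2_eq_square)
        show "0 \<le> ?Q u" using neg by simp
      qed
      then show "ennreal (2 * wmat_inner (g x) U (grad_mat F x) + wmat_inner (g x) (Theta g x U) U)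
          \<le> polar (wmat_inner (g x)) ?Q (grad_mat F x)" by simp
    qed
  qed
  moreover have "(\<integral>\<^sup>+x. ennreal ((wnorm (g x) (F x - matrix_inv Z *v (\<integral>z. g z *v F z \<partial>lborel)))\<^sup>2) \<partial>lborel)
          \<le> (\<integral>\<^sup>+x. ennreal (wmat_inner (g x) (inv (\<lambda>U. - Theta g x U) (grad_mat F x)) (grad_mat F x)) \<partial>lborel)"
    if C: "C1_fun F" and L: "F \<in> weighted_L2 g" and bij: "AE x in lborel. bij (Theta g x)" for F
  proof -
    obtain F1 where F: "has_C1 F F1" using C1_fun_obtain[OF C] .
    show ?thesis
    proof (rule variance_le_dual[OF g pd assms(2) F L assms(3)])
      show "AE x in lborel. \<forall>U. ennreal (2 * wmat_inner (g x) U (grad_mat F x) + wmat_inner (g x) (Theta g x U) U)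
         \<le> ennreal (wmat_inner (g x) (inv (\<lambda>U. - Theta g x U) (grad_mat F x)) (grad_mat F x))"
        using bij
        by eventually_elim (intro allI ennreal_leI le_inverse_form pd linear_Theta neg Theta_symmetric[OF g pd])
    qed
  qed
  ultimately show ?thesis by blast
qed

end
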